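(* There exist universal constants $c_3>0$ and $c_{\mathsf{lb}}>0$ such that the following holds. Let $3/4\le\gamma<1$ and let $T\ge\frac{c_3}{(1-\gamma)^2}$. There exists a $\gamma$-discounted MDP with $|\mathcal S|=4$ and $|\mathcal A|=2$ (rewards in $[0,1]$) such that synchronous Q-learning initialized at $Q_0\equiv0$ and run with either (i) learning rates $\eta_t=\frac{1}{1+c_\eta(1-\gamma)t}$ for all $t\ge0$, for any $c_\eta>0$, or (ii) constant learning rates $\eta_t\equiv\eta$ for any $\eta\in(0,1)$, satisfies $$\max_{s\in\mathcal S}\mathbb E\Big[\big|V_T(s)-V^\star(s)\big|^2\Big]\ge\frac{c_{\mathsf{lb}}}{(1-\gamma)^4T\log^2T}.$$
   Context: A discounted MDP $(\mathcal S,\mathcal A,P,r,\gamma)$ has finite state space $\mathcal S$, finite action space $\mathcal A$, transition kernel $P(\cdot\mid s,a)$, reward $r:\mathcal S\times\mathcal A\to[0,1]$ and discount $\gamma$; $Q^\star$ is the optimal Q-function and $V^\star(s)=\max_aQ^\star(s,a)$. Synchronous Q-learning: in each iteration $t=1,\dots,T$, for each $(s,a)$ an independent sample $s_t(s,a)\sim P(\cdot\mid s,a)$ is drawn (independent across pairs and iterations), and $Q_t(s,a)=(1-\eta_t)Q_{t-1}(s,a)+\eta_t\big(r(s,a)+\gamma\max_{a'}Q_{t-1}(s_t(s,a),a')\big)$; $V_t(s)=\max_aQ_t(s,a)$. The expectation is over the random samples. Logarithms are natural. *)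

theory Defs
  imports "HOL-Probability.Probability"
begin

text \<open>Finite MDP with states 0..<nS and actions 0..<nA.
  K s a :: nat pmf is the transition kernel P(.|s,a), r s a the reward.\<close>

definition valid_mdp :: "nat \<Rightarrow> nat \<Rightarrow> (nat \<Rightarrow> nat \<Rightarrow> nat pmf) \<Rightarrow> (nat \<Rightarrow> nat \<Rightarrow> real) \<Rightarrow> bool" where
  "valid_mdp nS nA K r \<longleftrightarrow>
     (\<forall>s<nS. \<forall>a<nA. set_pmf (K s a) \<subseteq> {..<nS} \<and> 0 \<le> r s a \<and> r s a \<le> 1)"

definition maxA :: "nat \<Rightarrow> (nat \<Rightarrow> real) \<Rightarrow> real" where
  "maxA nA f = Max (f ` {..<nA})"

text \<open>Optimal Q-function: the (unique) fixed point of the Bellman optimality operator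
  on the state-action pairs; set to 0 outside the state-action space.\<close>
definition Qstar :: "nat \<Rightarrow> nat \<Rightarrow> (nat \<Rightarrow> nat \<Rightarrow> nat pmf) \<Rightarrow> (nat \<Rightarrow> nat \<Rightarrow> real) \<Rightarrow> real
                     \<Rightarrow> nat \<Rightarrow> nat \<Rightarrow> real" where
  "Qstar nS nA K r \<gamma> = (THE Q. \<forall>s a. Q s a =
      (if s < nS \<and> a < nA
       then r s a + \<gamma> * (\<Sum>s'<nS. pmf (K s a) s' * maxA nA (Q s'))
       else 0))"

definition Vstar :: "nat \<Rightarrow> nat \<Rightarrow> (nat \<Rightarrow> nat \<Rightarrow> nat pmf) \<Rightarrow> (nat \<Rightarrow> nat \<Rightarrow> real) \<Rightarrow> real
                     \<Rightarrow> nat \<Rightarrow> real" where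
  "Vstar nS nA K r \<gamma> s = maxA nA (Qstar nS nA K r \<gamma> s)"

text \<open>Synchronous Q-learning with Q_0 = 0. The sample path \<omega> gives, for every iteration t
  and pair (s,a), the sampled next state \<omega> (t,s,a).\<close>
fun Qlearn :: "nat \<Rightarrow> (nat \<Rightarrow> nat \<Rightarrow> real) \<Rightarrow> real \<Rightarrow> (nat \<Rightarrow> real) \<Rightarrow> (nat \<times> nat \<times> nat \<Rightarrow> nat)
               \<Rightarrow> nat \<Rightarrow> nat \<Rightarrow> nat \<Rightarrow> real" where
  "Qlearn nA r \<gamma> \<eta> \<omega> 0 s a = 0"
| "Qlearn nA r \<gamma> \<eta> \<omega> (Suc t) s a =
     (1 - \<eta> (Suc t)) * Qlearn nA r \<gamma> \<eta> \<omega> t s a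
     + \<eta> (Suc t) * (r s a + \<gamma> * maxA nA (Qlearn nA r \<gamma> \<eta> \<omega> t (\<omega> (Suc t, s, a))))"

definition Vlearn :: "nat \<Rightarrow> (nat \<Rightarrow> nat \<Rightarrow> real) \<Rightarrow> real \<Rightarrow> (nat \<Rightarrow> real) \<Rightarrow> (nat \<times> nat \<times> nat \<Rightarrow> nat)
               \<Rightarrow> nat \<Rightarrow> nat \<Rightarrow> real" where
  "Vlearn nA r \<gamma> \<eta> \<omega> t s = maxA nA (Qlearn nA r \<gamma> \<eta> \<omega> t s)"

definition samples :: "nat \<Rightarrow> nat \<Rightarrow> (nat \<Rightarrow> nat \<Rightarrow> nat pmf) \<Rightarrow> nat \<Rightarrow> (nat \<times> nat \<times> nat \<Rightarrow> nat) pmf" where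
  "samples nS nA K T = Pi_pmf ({1..T} \<times> {..<nS} \<times> {..<nA}) 0 (\<lambda>(t, s, a). K s a)"

definition QL_error :: "nat \<Rightarrow> nat \<Rightarrow> (nat \<Rightarrow> nat \<Rightarrow> nat pmf) \<Rightarrow> (nat \<Rightarrow> nat \<Rightarrow> real) \<Rightarrow> real
                        \<Rightarrow> (nat \<Rightarrow> real) \<Rightarrow> nat \<Rightarrow> real" where
  "QL_error nS nA K r \<gamma> \<eta> T =
     Max ((\<lambda>s. measure_pmf.expectation (samples nS nA K T)
                 (\<lambda>\<omega>. \<bar>Vlearn nA r \<gamma> \<eta> \<omega> T s - Vstar nS nA K r \<gamma> s\<bar>^2)) ` {..<nS})"

end

theory Submission
  imports Defs
begin

text \<open>
In the hard instance state 2 is absorbing with reward 1, and both actions of the reward-1 state 1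
stay there with the same probability \<open>p\<close> and otherwise move to a worthless absorbing state; \<open>p\<close> is
chosen such that \<open>1 - \<gamma> p = 4/3 (1 - \<gamma>)\<close>. The error at state 2 is deterministic,
\<open>\<Prod>(1 - \<eta>\<^sub>i (1 - \<gamma>)) / (1 - \<gamma>)\<close>, and is large unless the step sizes are large enough to forget
the initialization. In the latter case the maximum over the two equally good actions of state 1 is
biased upwards: with \<open>M\<close> the mean and \<open>D\<close> the difference of the two estimates one has
\<open>V = M + |D| / 2\<close>, hence \<open>E M\<^sub>t\<^sub>+\<^sub>1 = (1 - \<eta> \<beta>) E M\<^sub>t + \<eta> (1 + \<gamma> p E|D\<^sub>t| / 2)\<close> with \<open>\<beta> = 1 - \<gamma> p\<close>,
and the gaps accumulate to a bias of order \<open>E|D| / (1 - \<gamma>)\<close>. Since \<open>D\<close> is driven by centered noise,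
\<open>E|D|\<close> is at least half the value obtained after restarting \<open>D\<close> from 0 at time \<open>t/2\<close>, which is
bounded below by comparing second and fourth moments.

Both families of step sizes are decreasing with \<open>t \<eta>\<^sub>t\<close> increasing; apart from one further
inequality, only this is used.
\<close>

section \<open>The hard instance\<close>

text \<open>The fresh value overwrites the old one, so only the draws of the other coordinates and
  of the new value remain, and independent draws commute.\<close>

lemma Pi_pmf_resample:
  assumes "finite A" "k \<in> A"
  shows "Pi_pmf A d p = bind_pmf (Pi_pmf A d p) (\<lambda>w. map_pmf (\<lambda>y. w(k := y)) (p k))"
proof -
  have A: "A = insert k (A - {k})" using assms by auto
  have P: "Pi_pmf A d p = map_pmf (\<lambda>(y, f). f(k := y)) (pair_pmf (p k) (Pi_pmf (A - {k}) d p))"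
    by (subst A, subst Pi_pmf_insert) (use assms in auto)
  show ?thesis
    unfolding P pair_pmf_def
    by (simp add: map_pmf_def bind_assoc_pmf bind_return_pmf)
       (rule bind_commute_pmf)
qed

text \<open>Fubini in a form that avoids conditional expectations: coordinate \<open>k\<close> is
  averaged out inside the expectation over whole paths. Finite supports turn the expectations into
  sums.\<close>

lemma expectation_Pi_pmf_resample:
  fixes F :: "('a \<Rightarrow> 'b) \<Rightarrow> real"
  assumes "finite A" "k \<in> A" "\<And>x. x \<in> A \<Longrightarrow> finite (set_pmf (p x))"
  shows "measure_pmf.expectation (Pi_pmf A d p) F =
    measure_pmf.expectation (Pi_pmf A d p) (\<lambda>w. measure_pmf.expectation (p k) (\<lambda>y. F (w(k := y))))"
proof -
  have fin: "finite (set_pmf (Pi_pmf A d p))"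
    using assms by (simp add: set_Pi_pmf finite_PiE_dflt)
  have fin': "finite (set_pmf (map_pmf (\<lambda>y. w(k := y)) (p k)))" for w
    using assms by simp
  have "measure_pmf.expectation (Pi_pmf A d p) F =
    measure_pmf.expectation (bind_pmf (Pi_pmf A d p) (\<lambda>w. map_pmf (\<lambda>y. w(k := y)) (p k))) F"
    using Pi_pmf_resample[of A k d p] assms by simp
  also have "\<dots> = (\<Sum>w\<in>set_pmf (Pi_pmf A d p). pmf (Pi_pmf A d p) w *\<^sub>R
      measure_pmf.expectation (map_pmf (\<lambda>y. w(k := y)) (p k)) F)"
    by (rule pmf_expectation_bind) (use fin fin' in auto)
  also have "\<dots> = measure_pmf.expectation (Pi_pmf A d p)
      (\<lambda>w. measure_pmf.expectation (map_pmf (\<lambda>y. w(k := y)) (p k)) F)"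
    by (subst integral_measure_pmf[OF fin]) auto
  finally show ?thesis by simp
qed

section \<open>The hard MDP and its optimal values\<close>

text \<open>State 0 is the worthless absorbing state: \<open>of_bool\<close> sends a success of the
  coin to state 1 and a failure to state 0.\<close>

definition hard_kernel :: "real \<Rightarrow> nat \<Rightarrow> nat \<Rightarrow> nat pmf" where
  "hard_kernel p s a = (if s = 1 then map_pmf of_bool (bernoulli_pmf p) else return_pmf s)"

definition hard_reward :: "nat \<Rightarrow> nat \<Rightarrow> real" where
  "hard_reward s a = of_bool (s = 1 \<or> s = 2)"

lemma hard_reward_simps [simp]:
  "hard_reward 0 a = 0" "hard_reward (Suc 0) a = 1" "hard_reward 2 a = 1"
  by (simp_all add: hard_reward_def)

lemma valid_mdp_hard: "valid_mdp 4 2 (hard_kernel p) hard_reward"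
  by (auto simp: valid_mdp_def hard_kernel_def hard_reward_def of_bool_def)

lemma maxA_2: "maxA 2 f = max (f 0) (f 1)"
  by (simp add: maxA_def lessThan_Suc numeral_2_eq_2 max.commute)

lemma finite_samples_hard: "finite (set_pmf (samples 4 2 (hard_kernel p) T))"
  unfolding samples_def
  by (subst set_Pi_pmf) (auto intro!: finite_PiE_dflt simp: hard_kernel_def)

text \<open>The fixed point equation is shown equivalent to \<open>Q = ?Q\<close>, which settles
  existence and uniqueness for the definite description at once. Both actions of a state satisfy the
  same equation, so each maximum is attained by either of them and every state leaves one linear
  equation.\<close>

lemma Qstar_hard:
  assumes p: "0 \<le> p" "p \<le> 1" and g: "0 \<le> \<gamma>" "\<gamma> < 1"
  shows "Qstar 4 2 (hard_kernel p) hard_reward \<gamma> = (\<lambda>s a. if s < 4 \<and> a < 2 then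
     (if s = 1 then 1 / (1 - \<gamma> * p) else if s = 2 then 1 / (1 - \<gamma>) else 0) else 0)"
    (is "_ = ?Q")
proof -
  have gp: "\<gamma> * p < 1"
    using mult_left_mono[of p 1 \<gamma>] p g by simp
  have S4: "(\<Sum>s<4. f s) = f 0 + f 1 + f 2 + f 3" for f :: "nat \<Rightarrow> real"
    by (simp add: eval_nat_numeral)
  have pm: "pmf (map_pmf of_bool (bernoulli_pmf p)) (0::nat) = 1 - p"
     "pmf (map_pmf of_bool (bernoulli_pmf p)) (1::nat) = p"
     "pmf (map_pmf of_bool (bernoulli_pmf p)) (2::nat) = 0"
     "pmf (map_pmf of_bool (bernoulli_pmf p)) (3::nat) = 0"
  proof -
    have "pmf (map_pmf of_bool (bernoulli_pmf p)) (of_bool b ::nat) = pmf (bernoulli_pmf p) b" for b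
      by (rule pmf_map_inj') (auto simp: inj_def)
    from this[of False] this[of True] p
    show "pmf (map_pmf of_bool (bernoulli_pmf p)) (0::nat) = 1 - p"
     "pmf (map_pmf of_bool (bernoulli_pmf p)) (1::nat) = p" by auto
    show "pmf (map_pmf of_bool (bernoulli_pmf p)) (2::nat) = 0"
     "pmf (map_pmf of_bool (bernoulli_pmf p)) (3::nat) = 0"
      by (auto simp: pmf_eq_0_set_pmf of_bool_def)
  qed
  have K: "(\<Sum>s'<4. pmf (hard_kernel p s a) s' * f s') =
     (if s = 1 then (1 - p) * f 0 + p * f 1 else f s)" if s4: "s < 4" for s a and f :: "nat \<Rightarrow> real"
  proof -
    consider "s = 0" | "s = 1" | "s = 2" | "s = 3" using s4 by linarith
    then show ?thesis using pm by cases (simp_all add: S4 hard_kernel_def indicator_def)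
  qed
  have fp: "(\<forall>s a. Q s a = (if s < 4 \<and> a < 2
       then hard_reward s a + \<gamma> * (\<Sum>s'<4. pmf (hard_kernel p s a) s' * maxA 2 (Q s')) else 0))
     \<longleftrightarrow> Q = ?Q" for Q :: "nat \<Rightarrow> nat \<Rightarrow> real"
  proof
    assume L: "\<forall>s a. Q s a = (if s < 4 \<and> a < 2
       then hard_reward s a + \<gamma> * (\<Sum>s'<4. pmf (hard_kernel p s a) s' * maxA 2 (Q s')) else 0)"
    have eq: "Q s a = hard_reward s a + \<gamma> * (if s = 1 then (1 - p) * maxA 2 (Q 0) + p * maxA 2 (Q 1)
        else maxA 2 (Q s))" if "s < 4" "a < 2" for s a
      using L[rule_format, of s a] K[OF that(1), of a "\<lambda>s'. maxA 2 (Q s')"] that by simp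
    have same: "Q s a = maxA 2 (Q s)" if "s < 4" "a < 2" for s a
    proof -
      have "Q s 0 = Q s 1" using eq[of s 0] eq[of s 1] that by (simp add: hard_reward_def)
      with that show ?thesis by (auto simp: maxA_2 less_2_cases_iff)
    qed
    have absorbing: "maxA 2 (Q s) = hard_reward s 0 / (1 - \<gamma>)" if "s < 4" "s \<noteq> 1" for s
      using eq[of s 0] same[of s 0] that g by (simp add: field_simps)
    have one: "maxA 2 (Q 1) = 1 / (1 - \<gamma> * p)"
      using eq[of 1 0] same[of 1 0] absorbing[of 0] gp by (simp add: field_simps hard_reward_def)
    show "Q = ?Q"
    proof (intro ext)
      fix s a show "Q s a = ?Q s a"
      proof (cases "s < 4 \<and> a < 2")
        case True
        then show ?thesis using same[of s a] absorbing[of s] one by (auto simp: hard_reward_def)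
      next
        case False
        then show ?thesis using L by auto
      qed
    qed
  next
    assume Q: "Q = ?Q"
    have mx: "maxA 2 (Q s) = (if s = 1 then 1 / (1 - \<gamma> * p) else if s = 2 then 1 / (1 - \<gamma>) else 0)"
      if "s < 4" for s using that by (simp add: Q maxA_2)
    show "\<forall>s a. Q s a = (if s < 4 \<and> a < 2
       then hard_reward s a + \<gamma> * (\<Sum>s'<4. pmf (hard_kernel p s a) s' * maxA 2 (Q s')) else 0)"
    proof (intro allI)
      fix s a
      have "?Q s a = (if s < 4 \<and> a < 2 then hard_reward s a + \<gamma> *
         (if s = 1 then (1 - p) * maxA 2 (Q 0) + p * maxA 2 (Q 1) else maxA 2 (Q s)) else 0)"
        using gp g by (auto simp: mx hard_reward_def field_simps)
      then show "Q s a = (if s < 4 \<and> a < 2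
         then hard_reward s a + \<gamma> * (\<Sum>s'<4. pmf (hard_kernel p s a) s' * maxA 2 (Q s')) else 0)"
        using K[of s a "\<lambda>s'. maxA 2 (Q s')"] by (simp add: Q)
    qed
  qed
  show ?thesis unfolding Qstar_def fp by simp
qed

lemma Vstar_hard:
  assumes "0 \<le> p" "p \<le> 1" "0 \<le> \<gamma>" "\<gamma> < 1"
  shows "Vstar 4 2 (hard_kernel p) hard_reward \<gamma> 1 = 1 / (1 - \<gamma> * p)"
    "Vstar 4 2 (hard_kernel p) hard_reward \<gamma> 2 = 1 / (1 - \<gamma>)"
  by (simp_all add: Vstar_def maxA_2 Qstar_hard[OF assms])

section \<open>Q-learning on the hard MDP\<close>

lemma samples_hard_support:
  assumes "w \<in> set_pmf (samples 4 2 (hard_kernel p) T)" "1 \<le> t" "t \<le> T" "s < 4" "a < 2"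
  shows "w (t, s, a) \<in> set_pmf (hard_kernel p s a)"
  using assms unfolding samples_def
  by (subst (asm) set_Pi_pmf) (auto simp: PiE_dflt_def)

lemma Qlearn_hard_0:
  assumes w: "w \<in> set_pmf (samples 4 2 (hard_kernel p) T)" and "t \<le> T" "a < 2"
  shows "Qlearn 2 hard_reward \<gamma> \<eta> w t 0 a = 0"
  using assms(2,3)
proof (induction t arbitrary: a)
  case (Suc t)
  have "w (Suc t, 0, a) = 0"
    using samples_hard_support[OF w, of "Suc t" 0 a] Suc.prems by (simp add: hard_kernel_def)
  then show ?case using Suc by (simp add: maxA_2)
qed simp

lemma Qlearn_hard_2:
  assumes w: "w \<in> set_pmf (samples 4 2 (hard_kernel p) T)" and "t \<le> T" "a < 2" and "\<gamma> < 1"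
  shows "Qlearn 2 hard_reward \<gamma> \<eta> w t 2 a = (1 - (\<Prod>i=1..t. 1 - \<eta> i * (1 - \<gamma>))) / (1 - \<gamma>)"
  using assms(2,3)
proof (induction t arbitrary: a)
  case (Suc t)
  have "w (Suc t, 2, a) = 2"
    using samples_hard_support[OF w, of "Suc t" 2 a] Suc.prems by (simp add: hard_kernel_def)
  moreover define R where "R = (\<Prod>i=1..t. 1 - \<eta> i * (1 - \<gamma>))"
  moreover have "(1 - \<eta> (Suc t)) * ((1 - R) / (1 - \<gamma>)) + \<eta> (Suc t) * (1 + \<gamma> * ((1 - R) / (1 - \<gamma>)))
      = (1 - R * (1 - \<eta> (Suc t) * (1 - \<gamma>))) / (1 - \<gamma>)"
    using \<open>\<gamma> < 1\<close> by (simp add: divide_simps) (simp add: algebra_simps)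
  ultimately show ?case using Suc by (simp add: maxA_2)
qed simp

text \<open>The iteration at state 1 with the value of state 0 already set to 0. It matches
  \<open>Qlearn\<close> on the support of the samples, while its bounds hold for every path
  \<open>w\<close>, so that later estimates are pointwise.\<close>

fun qval :: "real \<Rightarrow> (nat \<Rightarrow> real) \<Rightarrow> nat \<Rightarrow> (nat \<times> nat \<times> nat \<Rightarrow> nat) \<Rightarrow> nat \<Rightarrow> real" where
  "qval \<gamma> \<eta> 0 w a = 0"
| "qval \<gamma> \<eta> (Suc t) w a = (1 - \<eta> (Suc t)) * qval \<gamma> \<eta> t w a
     + \<eta> (Suc t) * (1 + \<gamma> * (of_bool (w (Suc t, 1, a) = 1) * max (qval \<gamma> \<eta> t w 0) (qval \<gamma> \<eta> t w 1)))"

lemma Qlearn_hard_1: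
  assumes w: "w \<in> set_pmf (samples 4 2 (hard_kernel p) T)" and "t \<le> T" "a < 2"
  shows "Qlearn 2 hard_reward \<gamma> \<eta> w t 1 a = qval \<gamma> \<eta> t w a"
  using assms(2,3)
proof (induction t arbitrary: a)
  case (Suc t)
  have "w (Suc t, 1, a) \<in> {0, 1}"
    using samples_hard_support[OF w, of "Suc t" 1 a] Suc.prems by (auto simp: hard_kernel_def of_bool_def)
  then show ?case
    using Suc.IH[of 0] Suc.IH[of 1] Suc.IH[of a] Suc.prems
      Qlearn_hard_0[OF w, of t 0 \<gamma> \<eta>] Qlearn_hard_0[OF w, of t 1 \<gamma> \<eta>]
    by (auto simp: maxA_2)
qed simp

lemma expectation_cong_support:
  assumes "\<And>x. x \<in> set_pmf P \<Longrightarrow> f x = (g x :: real)"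
  shows "measure_pmf.expectation P f = measure_pmf.expectation P g"
  by (intro integral_cong_AE) (auto simp: AE_measure_pmf_iff assms)

lemma QL_error_ge_absorbing:
  assumes "0 \<le> p" "p \<le> 1" "0 \<le> \<gamma>" "\<gamma> < 1"
  shows "((\<Prod>i=1..T. 1 - \<eta> i * (1 - \<gamma>)) / (1 - \<gamma>))^2 \<le> QL_error 4 2 (hard_kernel p) hard_reward \<gamma> \<eta> T"
proof -
  let ?e = "\<lambda>s. measure_pmf.expectation (samples 4 2 (hard_kernel p) T)
                 (\<lambda>w. \<bar>Vlearn 2 hard_reward \<gamma> \<eta> w T s - Vstar 4 2 (hard_kernel p) hard_reward \<gamma> s\<bar>^2)"
  have "?e 2 = measure_pmf.expectation (samples 4 2 (hard_kernel p) T)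
      (\<lambda>w. ((\<Prod>i=1..T. 1 - \<eta> i * (1 - \<gamma>)) / (1 - \<gamma>))^2)"
    by (rule expectation_cong_support)
       (simp add: Vlearn_def maxA_2 Qlearn_hard_2 Vstar_hard assms diff_divide_distrib flip: abs_divide)
  then have "?e 2 = ((\<Prod>i=1..T. 1 - \<eta> i * (1 - \<gamma>)) / (1 - \<gamma>))^2" by simp
  moreover have "?e 2 \<le> QL_error 4 2 (hard_kernel p) hard_reward \<gamma> \<eta> T"
    unfolding QL_error_def by (rule Max_ge) auto
  ultimately show ?thesis by simp
qed

text \<open>By Jensen the mean squared error at state 1 is at least the squared bias;
  \<open>0 \<le> b\<close> allows squaring the lower bound.\<close>

lemma QL_error_ge_bias:
  assumes "0 \<le> p" "p \<le> 1" "0 \<le> \<gamma>" "\<gamma> < 1"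
    and b: "0 \<le> b" "b \<le> measure_pmf.expectation (samples 4 2 (hard_kernel p) T)
           (\<lambda>w. max (qval \<gamma> \<eta> T w 0) (qval \<gamma> \<eta> T w 1)) - 1 / (1 - \<gamma> * p)"
  shows "b^2 \<le> QL_error 4 2 (hard_kernel p) hard_reward \<gamma> \<eta> T"
proof -
  let ?P = "samples 4 2 (hard_kernel p) T"
  let ?V = "\<lambda>w. max (qval \<gamma> \<eta> T w 0) (qval \<gamma> \<eta> T w 1)"
  let ?e = "\<lambda>s. measure_pmf.expectation ?P
                 (\<lambda>w. \<bar>Vlearn 2 hard_reward \<gamma> \<eta> w T s - Vstar 4 2 (hard_kernel p) hard_reward \<gamma> s\<bar>^2)"
  let ?c = "1 / (1 - \<gamma> * p)"
  have int: "integrable ?P f" for f :: "_ \<Rightarrow> real"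
    by (rule integrable_measure_pmf_finite[OF finite_samples_hard])
  have "?e 1 = measure_pmf.expectation ?P (\<lambda>w. (?V w - ?c)^2)"
    using Qlearn_hard_1[of _ p T T _ \<gamma> \<eta>]
    by (intro expectation_cong_support)
       (simp add: Vlearn_def maxA_2 Vstar_hard[OF assms(1-4)] del: One_nat_def)
  moreover have "b^2 \<le> (measure_pmf.expectation ?P (\<lambda>w. ?V w - ?c))^2"
    using b by (intro power_mono) (simp_all add: int)
  moreover have "(measure_pmf.expectation ?P (\<lambda>w. ?V w - ?c))^2
      \<le> measure_pmf.expectation ?P (\<lambda>w. (?V w - ?c)^2)"
    using measure_pmf.variance_positive[of ?P "\<lambda>w. ?V w - ?c"]
    by (subst (asm) measure_pmf.variance_eq) (auto simp: int)
  moreover have "?e 1 \<le> QL_error 4 2 (hard_kernel p) hard_reward \<gamma> \<eta> T"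
    unfolding QL_error_def by (rule Max_ge) auto
  ultimately show ?thesis by linarith
qed

section \<open>Elementary inequalities\<close>

text \<open>The equilibrium of the recursion is \<open>c / h\<close>; the minimum combines this cap
  with the linear growth \<open>c * j\<close> from 0.\<close>

lemma affine_recursion_upper:
  fixes x :: "nat \<Rightarrow> real"
  assumes "x k = 0" and step: "\<And>i. k \<le> i \<Longrightarrow> i < k + n \<Longrightarrow> x (Suc i) \<le> (1 - h) * x i + c"
    and h: "0 < h" "h \<le> 1" and c: "0 \<le> c" and "j \<le> n"
  shows "x (k + j) \<le> c / h * min 1 (h * real j)"
  using \<open>j \<le> n\<close>
proof (induction j)
  case 0
  then show ?case using assms by simp
next
  case (Suc j)
  have "x (k + Suc j) \<le> (1 - h) * x (k + j) + c" using step[of "k + j"] Suc.prems by simp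
  also have "\<dots> \<le> (1 - h) * (c / h * min 1 (h * real j)) + c"
    using Suc h by (intro add_right_mono mult_left_mono) auto
  also have "\<dots> = c / h * ((1 - h) * min 1 (h * real j) + h)"
    using h by (simp add: field_simps)
  also have "\<dots> \<le> c / h * min 1 (h * real (Suc j))"
  proof (rule mult_left_mono)
    have "(1 - h) * min 1 (h * real j) \<le> (1 - h) * 1" using h by (intro mult_left_mono) auto
    moreover have "(1 - h) * min 1 (h * real j) \<le> 1 * (h * real j)"
      using h by (intro mult_mono) auto
    ultimately show "(1 - h) * min 1 (h * real j) + h \<le> min 1 (h * real (Suc j))"
      by (simp add: algebra_simps)
  qed (use h c in simp)
  finally show ?case .
qed

text \<open>Compares with the exact solution \<open>c / h * (1 - (1 - h) ^ n)\<close> and uses (1 -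
  h)^n \<le> exp (- h n) \<le> 1 / (1 + h n).\<close>

lemma affine_recursion_lower:
  fixes x :: "nat \<Rightarrow> real"
  assumes "x k = 0" and step: "\<And>i. k \<le> i \<Longrightarrow> i < k + n \<Longrightarrow> (1 - h) * x i + c \<le> x (Suc i)"
    and h: "0 < h" "h \<le> 1" and c: "0 \<le> c"
  shows "c / h * (min 1 (h * real n) / 2) \<le> x (k + n)"
proof -
  have *: "c / h * (1 - (1 - h) ^ j) \<le> x (k + j)" if "j \<le> n" for j
    using that
  proof (induction j)
    case 0
    then show ?case using assms by simp
  next
    case (Suc j)
    have "c / h * (1 - (1 - h) ^ Suc j) = (1 - h) * (c / h * (1 - (1 - h) ^ j)) + c"
      using h by (simp add: field_simps)
    also have "\<dots> \<le> (1 - h) * x (k + j) + c"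
      using Suc h by (intro add_right_mono mult_left_mono) auto
    also have "\<dots> \<le> x (k + Suc j)" using step[of "k + j"] Suc.prems by simp
    finally show ?case .
  qed
  have nn: "0 \<le> h * real n" using h by simp
  have "(1 - h) ^ n \<le> exp (-h) ^ n"
    using h exp_ge_add_one_self[of "-h"] by (intro power_mono) auto
  also have "\<dots> = 1 / exp (h * real n)"
    using exp_of_nat_mult[of n "-h"] by (simp add: exp_minus inverse_eq_divide mult.commute)
  also have "\<dots> \<le> 1 / (1 + h * real n)"
    using nn exp_ge_add_one_self[of "h * real n"] by (intro divide_left_mono mult_pos_pos) auto
  finally have "(1 - h) ^ n \<le> 1 / (1 + h * real n)" .
  moreover have "1 / (1 + h * real n) \<le> 1 - min 1 (h * real n) / 2"
  proof (cases "h * real n \<le> 1")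
    case True
    then have "(h * real n) * (h * real n) \<le> (h * real n) * 1" using nn by (intro mult_left_mono) auto
    then show ?thesis using nn True by (simp add: field_simps)
  next
    case False
    then show ?thesis by (simp add: field_simps)
  qed
  ultimately have "min 1 (h * real n) / 2 \<le> 1 - (1 - h) ^ n" by linarith
  then have "c / h * (min 1 (h * real n) / 2) \<le> c / h * (1 - (1 - h) ^ n)"
    using h c by (intro mult_left_mono) auto
  with *[of n] show ?thesis by simp
qed

text \<open>Integrated, this bounds a first absolute moment from below by second and fourth moments,
  with the truncation level \<open>a\<close> free to be optimized.\<close>

lemma square_le_abs_plus_fourth:
  fixes x a :: real
  assumes "0 < a"
  shows "x^2 \<le> a * \<bar>x\<bar> + x^4 / a^2"
proof (cases "\<bar>x\<bar> \<le> a")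
  case True
  have "x^2 = \<bar>x\<bar> * \<bar>x\<bar>" by (simp add: power2_eq_square)
  also have "\<dots> \<le> a * \<bar>x\<bar>" using True by (intro mult_right_mono) auto
  finally show ?thesis by (simp add: add_increasing2)
next
  case False
  then have "a^2 \<le> \<bar>x\<bar>^2" using assms by (intro power_mono) auto
  then have "x^2 * a^2 \<le> x^2 * x^2" by (intro mult_left_mono) auto
  then have "x^2 \<le> x^4 / a^2" using assms by (simp add: field_simps flip: power_add)
  then show ?thesis using assms by (simp add: add_increasing)
qed

lemma sum_inverse_le_ln:
  assumes "1 \<le> n"
  shows "(\<Sum>i=1..n. 1 / real i) \<le> 1 + ln (real n)"
  using assms
proof (induction n rule: nat_induct_at_least)
  case (Suc n)
  have "ln (real n / real (Suc n)) \<le> real n / real (Suc n) - 1"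
    using Suc by (intro ln_le_minus_one) auto
  also have "\<dots> = - (1 / real (Suc n))" by (simp add: field_simps)
  finally have "1 / real (Suc n) \<le> ln (real (Suc n)) - ln (real n)"
    using Suc by (simp add: ln_div)
  with Suc show ?case by simp
qed simp

section \<open>Moments of the action gap\<close>

locale hard_instance =
  fixes \<gamma> :: real and T :: nat and \<eta> :: "nat \<Rightarrow> real"
  assumes gamma: "3/4 \<le> \<gamma>" "\<gamma> < 1"
    and eta_pos: "1 \<le> t \<Longrightarrow> 0 < \<eta> t"
    and eta_le: "1 \<le> t \<Longrightarrow> \<eta> t \<le> 1"
begin

definition p :: real where "p = (4 * \<gamma> - 1) / (3 * \<gamma>)"
text \<open>The effective horizon, which bounds all action values and serves as the scale for every
  estimate.\<close>

definition B :: real where "B = 1 / (1 - \<gamma>)"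
definition \<beta> :: real where "\<beta> = 4/3 * (1 - \<gamma>)"

lemma gamma_p: "\<gamma> * p = 1 - \<beta>" and p01: "0 \<le> p" "p \<le> 1"
  using gamma by (simp_all add: p_def \<beta>_def field_simps)

lemma beta: "0 < \<beta>" "\<beta> \<le> 1/3"
  using gamma by (simp_all add: \<beta>_def)

lemma B_ge: "4 \<le> B"
  using gamma by (simp add: B_def field_simps)

lemma inverse_beta: "1 / \<beta> = 3/4 * B"
  by (simp add: B_def \<beta>_def)

definition E :: "((nat \<times> nat \<times> nat \<Rightarrow> nat) \<Rightarrow> real) \<Rightarrow> real" where
  "E F = measure_pmf.expectation (samples 4 2 (hard_kernel p) T) F"

lemma integrable_samples: "integrable (measure_pmf (samples 4 2 (hard_kernel p) T)) (f :: _ \<Rightarrow> real)"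
  by (rule integrable_measure_pmf_finite[OF finite_samples_hard])

lemma E_simps [simp]:
  "E (\<lambda>w. f w + g w) = E f + E g" "E (\<lambda>w. f w - g w) = E f - E g"
  "E (\<lambda>w. c * f w) = c * E f" "E (\<lambda>w. f w / c) = E f / c" "E (\<lambda>w. c) = c"
  by (simp_all add: E_def integrable_samples)

lemma E_mono: "(\<And>w. f w \<le> g w) \<Longrightarrow> E f \<le> E g"
  unfolding E_def by (intro integral_mono integrable_samples)

lemma E_square_ge: "(E f)^2 \<le> E (\<lambda>w. (f w)^2)"
  using measure_pmf.variance_positive[of "samples 4 2 (hard_kernel p) T" f]
  unfolding E_def by (subst (asm) measure_pmf.variance_eq) (auto simp: integrable_samples)

lemma E_resample:
  assumes "1 \<le> t" "t \<le> T" "a < 2"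
  shows "E F = E (\<lambda>w. p * F (w((t,1,a) := 1)) + (1 - p) * F (w((t,1,a) := 0)))"
proof -
  have "E F = E (\<lambda>w. measure_pmf.expectation (hard_kernel p 1 a) (\<lambda>y. F (w((t,1,a) := y))))"
    unfolding E_def samples_def using assms
    by (subst expectation_Pi_pmf_resample[where k = "(t,1,a)"]) (auto simp: hard_kernel_def)
  also have "\<dots> = E (\<lambda>w. p * F (w((t,1,a) := 1)) + (1 - p) * F (w((t,1,a) := 0)))"
    using p01 by (simp add: hard_kernel_def mult.commute del: E_simps)
  finally show ?thesis .
qed

text \<open>Averages over the two transitions out of state 1 at time \<open>Suc t\<close>. Their
  outcomes are separate arguments of \<open>F\<close>, and \<open>inv\<close> says that the
  remaining dependence on \<open>w\<close> does not involve these coordinates.\<close>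

lemma E_step:
  assumes t: "t < T" and inv: "\<And>b b' w a y. F b b' (w((Suc t,1,a) := y)) = F b b' w"
  shows "E (\<lambda>w. F (w (Suc t,1,0) = 1) (w (Suc t,1,1) = 1) w) =
    E (\<lambda>w. p^2 * F True True w + p * (1-p) * (F True False w + F False True w) + (1-p)^2 * F False False w)"
proof -
  have inv': "F b b' (w((Suc t,Suc 0,a) := y)) = F b b' w" for b b' w a y
    using inv[of b b' w a y] by simp
  have "E (\<lambda>w. F (w (Suc t,1,0) = 1) (w (Suc t,1,1) = 1) w) =
     E (\<lambda>w. p * F True (w (Suc t,1,1) = 1) w + (1 - p) * F False (w (Suc t,1,1) = 1) w)"
    by (subst E_resample[of "Suc t" 0]) (use t in \<open>simp_all add: inv'\<close>)
  also have "\<dots> = E (\<lambda>w. p * (p * F True True w + (1 - p) * F False True w)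
      + (1 - p) * (p * F True False w + (1 - p) * F False False w))"
    by (subst E_resample[of "Suc t" 1]) (use t in \<open>simp_all add: inv'\<close>)
  also have "\<dots> = E (\<lambda>w. p^2 * F True True w + p * (1-p) * (F True False w + F False True w)
      + (1-p)^2 * F False False w)"
    by (rule arg_cong[where f = E]) (auto simp: fun_eq_iff algebra_simps power2_eq_square)
  finally show ?thesis .
qed

section \<open>Mean, maximum and gap of the two action values at state 1\<close>

abbreviation q :: "nat \<Rightarrow> (nat \<times> nat \<times> nat \<Rightarrow> nat) \<Rightarrow> nat \<Rightarrow> real" where
  "q \<equiv> qval \<gamma> \<eta>"

definition V :: "nat \<Rightarrow> (nat \<times> nat \<times> nat \<Rightarrow> nat) \<Rightarrow> real" where
  "V t w = max (q t w 0) (q t w 1)"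
definition M :: "nat \<Rightarrow> (nat \<times> nat \<times> nat \<Rightarrow> nat) \<Rightarrow> real" where
  "M t w = (q t w 0 + q t w 1) / 2"

text \<open>The difference of the two action values at state 1, restarted from 0 at time \<open>k\<close>.\<close>

primrec gap :: "nat \<Rightarrow> nat \<Rightarrow> (nat \<times> nat \<times> nat \<Rightarrow> nat) \<Rightarrow> real" where
  "gap k 0 w = 0"
| "gap k (Suc t) w = (if t < k then 0 else (1 - \<eta> (Suc t)) * gap k t w
      + \<eta> (Suc t) * \<gamma> * (of_bool (w (Suc t,1,0) = 1) - of_bool (w (Suc t,1,1) = 1)) * V t w)"

lemma gap_early: "t \<le> k \<Longrightarrow> gap k t w = 0"
  by (induction t) auto

lemma gap_0: "gap 0 t w = q t w 0 - q t w 1"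
  by (induction t) (simp_all add: V_def, simp add: algebra_simps)

lemma V_eq: "V t w = M t w + \<bar>gap 0 t w\<bar> / 2"
  by (simp add: V_def M_def gap_0 max_def field_simps)

text \<open>The restarted gap is driven by the same noise, with the same \<open>V\<close>, as the
  original one, so after time \<open>k\<close> their difference only contracts.\<close>

lemma gap_split:
  assumes "k \<le> t"
  shows "gap 0 t w = (\<Prod>i=Suc k..t. 1 - \<eta> i) * gap 0 k w + gap k t w"
  using assms
proof (induction t rule: dec_induct)
  case base
  then show ?case by (simp add: gap_early)
next
  case (step t)
  then show ?case by (simp add: algebra_simps)
qed

lemma q_upd [simp]: "t < i \<Longrightarrow> q t (w((i,s,a') := y)) a = q t w a"
  by (induction t arbitrary: a) simp_all

lemma V_upd [simp]: "t < i \<Longrightarrow> V t (w((i,s,a') := y)) = V t w"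
  by (simp add: V_def)

lemma gap_upd [simp]: "t < i \<Longrightarrow> gap k t (w((i,s,a') := y)) = gap k t w"
  by (induction t) simp_all

lemma q_bounds: "0 \<le> q t w a \<and> q t w a \<le> B"
proof (induction t arbitrary: a)
  case 0
  then show ?case using B_ge by simp
next
  case (Suc t)
  let ?x = "of_bool (w (Suc t, 1, a) = 1) * max (q t w 0) (q t w 1) :: real"
  have x: "0 \<le> ?x" "?x \<le> B" using Suc[of 0] Suc[of 1] B_ge by auto
  have "\<gamma> * ?x \<le> \<gamma> * B" using x gamma by (intro mult_left_mono) auto
  also have "\<gamma> * B = B - 1" using gamma by (simp add: B_def field_simps)
  finally have "1 + \<gamma> * ?x \<le> B" by simp
  moreover have "0 \<le> 1 + \<gamma> * ?x" using x gamma by simp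
  ultimately have "(1 - \<eta> (Suc t)) * q t w a + \<eta> (Suc t) * y \<le> B"
      "0 \<le> (1 - \<eta> (Suc t)) * q t w a + \<eta> (Suc t) * y" if "y = 1 + \<gamma> * ?x" for y
    using Suc[of a] eta_pos[of "Suc t"] eta_le[of "Suc t"] unfolding that[symmetric]
    by (auto intro!: convex_bound_le add_nonneg_nonneg mult_nonneg_nonneg)
  then show ?case by simp
qed

lemma V_bounds: "0 \<le> V t w" "V t w \<le> B"
  using q_bounds[of t w 0] q_bounds[of t w 1] by (auto simp: V_def)

lemma E_M_Suc:
  assumes "t < T"
  shows "E (M (Suc t)) = (1 - \<eta> (Suc t) * \<beta>) * E (M t)
     + \<eta> (Suc t) * (1 + (1 - \<beta>) * (E (\<lambda>w. \<bar>gap 0 t w\<bar>) / 2))"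
proof -
  let ?x = "\<lambda>w. (1 - \<eta> (Suc t)) * M t w + \<eta> (Suc t)" and ?y = "\<lambda>w. \<eta> (Suc t) * (\<gamma> * V t w) / 2"
  let ?F = "\<lambda>b b' w. ?x w + (of_bool b + of_bool b') * ?y w"
  have id: "p^2 * (x + 2 * y) + p * (1-p) * ((x + y) + (x + y)) + (1-p)^2 * x = x + 2 * p * y" for x y :: real
    by (simp add: power2_eq_square algebra_simps)
  have "E (M (Suc t)) = E (\<lambda>w. ?F (w (Suc t,1,0) = 1) (w (Suc t,1,1) = 1) w)"
    by (rule arg_cong[where f = E]) (simp add: fun_eq_iff M_def V_def field_simps)
  also have "\<dots> = E (\<lambda>w. p^2 * ?F True True w + p * (1-p) * (?F True False w + ?F False True w)
      + (1-p)^2 * ?F False False w)"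
    by (rule E_step[OF assms, where F = ?F]) (simp add: M_def)
  also have "\<dots> = E (\<lambda>w. (1 - \<eta> (Suc t)) * M t w + \<eta> (Suc t) * (1 + \<gamma> * p * V t w))"
    by (intro arg_cong[where f = E] ext) (simp add: id[of "?x _" "?y _", simplified], simp add: algebra_simps)
  also have "\<dots> = (1 - \<eta> (Suc t)) * E (M t) + \<eta> (Suc t) * (1 + (1 - \<beta>) * (E (M t) + E (\<lambda>w. \<bar>gap 0 t w\<bar>) / 2))"
    by (simp add: V_eq gamma_p)
  finally show ?thesis by (simp add: algebra_simps)
qed

text \<open>The difference of the two independent coins is 0 with probability
  \<open>p^2 + (1-p)^2\<close> and 1 or -1 with probability \<open>p * (1-p)\<close> each. The
  weight \<open>S\<close> depends on the past; it will be a sign or the constant 1.\<close>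

lemma E_gap_Suc:
  assumes "k \<le> t" "t < T" and S: "\<And>w a y. S (w((Suc t,1,a) := y)) = S w"
  shows "E (\<lambda>w. S w * f (gap k (Suc t) w)) =
    E (\<lambda>w. S w * ((p^2 + (1-p)^2) * f ((1 - \<eta> (Suc t)) * gap k t w) + p * (1-p) *
      (f ((1 - \<eta> (Suc t)) * gap k t w + \<eta> (Suc t) * \<gamma> * V t w)
       + f ((1 - \<eta> (Suc t)) * gap k t w - \<eta> (Suc t) * \<gamma> * V t w))))"
proof -
  let ?F = "\<lambda>b b' w. S w * f ((1 - \<eta> (Suc t)) * gap k t w
      + \<eta> (Suc t) * \<gamma> * (of_bool b - of_bool b') * V t w)"
  have "E (\<lambda>w. S w * f (gap k (Suc t) w)) = E (\<lambda>w. ?F (w (Suc t,1,0) = 1) (w (Suc t,1,1) = 1) w)"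
    using assms(1) by (intro arg_cong[where f = E]) (simp add: fun_eq_iff)
  also have "\<dots> = E (\<lambda>w. p^2 * ?F True True w + p * (1-p) * (?F True False w + ?F False True w)
      + (1-p)^2 * ?F False False w)"
    using S by (intro E_step[OF assms(2), where F = ?F]) simp
  also have "\<dots> = E (\<lambda>w. S w * ((p^2 + (1-p)^2) * f ((1 - \<eta> (Suc t)) * gap k t w) + p * (1-p) *
      (f ((1 - \<eta> (Suc t)) * gap k t w + \<eta> (Suc t) * \<gamma> * V t w)
       + f ((1 - \<eta> (Suc t)) * gap k t w - \<eta> (Suc t) * \<gamma> * V t w))))"
    by (rule arg_cong[where f = E], rule ext) (simp add: algebra_simps)
  finally show ?thesis .
qed

lemma p_sum: "p^2 + (1-p)^2 = 1 - 2 * (p * (1-p))"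
  by (simp add: power2_eq_square algebra_simps)

text \<open>By convexity, adding the centered part \<open>gap k t\<close> to the part already present at time \<open>k\<close>
  does not decrease the mean absolute value.\<close>

lemma E_sgn_gap:
  assumes "k \<le> t" "t \<le> T"
  shows "E (\<lambda>w. sgn (gap 0 k w) * gap k t w) = 0"
  using assms
proof (induction t rule: dec_induct)
  case base
  then show ?case by (simp add: gap_early)
next
  case (step t)
  have "E (\<lambda>w. sgn (gap 0 k w) * gap k (Suc t) w) =
     E (\<lambda>w. (1 - \<eta> (Suc t)) * (sgn (gap 0 k w) * gap k t w))"
  proof -
    have id: "z * ((p^2 + (1-p)^2) * (c * x) + p * (1-p) * ((c * x + v) + (c * x - v))) = c * (z * x)"
      for c x v z :: real
      unfolding p_sum by (simp add: algebra_simps)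
    have kt: "k \<le> t" "t < T" and inv: "sgn (gap 0 k (w((Suc t,1,a) := y))) = sgn (gap 0 k w)" for w a y
      using step by simp_all
    show ?thesis
      using E_gap_Suc[OF kt, of "\<lambda>w. sgn (gap 0 k w)" "\<lambda>x. x"] inv unfolding id by (simp only:)
  qed
  with step show ?case by (simp del: gap.simps)
qed

text \<open>With \<open>a\<close> the contraction from \<open>k\<close> to \<open>t\<close>, the
  tangent inequality for the absolute value and \<open>E_sgn_gap\<close> give a E|gap 0 k| \<le>
  E|gap 0 t|. The triangle inequality then costs a factor 2.\<close>

lemma E_abs_gap_restart:
  assumes "k \<le> t" "t \<le> T"
  shows "E (\<lambda>w. \<bar>gap k t w\<bar>) / 2 \<le> E (\<lambda>w. \<bar>gap 0 t w\<bar>)"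
proof -
  define a where "a = (\<Prod>i=Suc k..t. 1 - \<eta> i)"
  have a: "0 \<le> a" unfolding a_def using eta_le by (intro prod_nonneg) auto
  have D: "gap 0 t w = a * gap 0 k w + gap k t w" for w
    unfolding a_def by (rule gap_split[OF assms(1)])
  have "E (\<lambda>w. a * \<bar>gap 0 k w\<bar> + sgn (gap 0 k w) * gap k t w) \<le> E (\<lambda>w. \<bar>gap 0 t w\<bar>)"
  proof (rule E_mono)
    fix w
    show "a * \<bar>gap 0 k w\<bar> + sgn (gap 0 k w) * gap k t w \<le> \<bar>gap 0 t w\<bar>"
      unfolding D by (cases "gap 0 k w" "0::real" rule: linorder_cases) auto
  qed
  then have 1: "a * E (\<lambda>w. \<bar>gap 0 k w\<bar>) \<le> E (\<lambda>w. \<bar>gap 0 t w\<bar>)"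
    using E_sgn_gap[OF assms] by simp
  have "E (\<lambda>w. \<bar>gap k t w\<bar>) \<le> E (\<lambda>w. \<bar>gap 0 t w\<bar> + a * \<bar>gap 0 k w\<bar>)"
  proof (rule E_mono)
    fix w
    have "\<bar>a * gap 0 k w\<bar> = a * \<bar>gap 0 k w\<bar>" using a by (simp add: abs_mult)
    then show "\<bar>gap k t w\<bar> \<le> \<bar>gap 0 t w\<bar> + a * \<bar>gap 0 k w\<bar>"
      unfolding D by linarith
  qed
  with 1 show ?thesis by simp
qed

section \<open>Second and fourth moments of the restarted gap\<close>

text \<open>Bounds the conditional variance of the noise driving the gap, as \<open>V \<le> B\<close>.\<close>

definition s :: real where "s = 2 * p * (1 - p) * \<gamma>^2 * B^2"

text \<open>The variance is of order \<open>B\<close> and not \<open>B^2\<close>, because the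
  failure probability \<open>1 - p\<close> is of order \<open>1 / B\<close>.\<close>

lemma s_bounds: "4/9 * B \<le> s" "s \<le> 2/3 * B" "0 < s"
proof -
  have "s = 2 * (\<gamma> * p) * (\<gamma> - \<gamma> * p) * B^2"
    by (simp add: s_def power2_eq_square algebra_simps)
  also have "\<dots> = 2 * (4 * \<gamma> - 1) / 9 * ((1 - \<gamma>) * B) * B"
    unfolding gamma_p \<beta>_def by (simp add: power2_eq_square field_simps)
  also have "(1 - \<gamma>) * B = 1" using gamma by (simp add: B_def)
  finally have s: "s = 2 * (4 * \<gamma> - 1) / 9 * B" by simp
  show "4/9 * B \<le> s" unfolding s using gamma B_ge by (intro mult_right_mono) auto
  then show "0 < s" using B_ge by simp
  show "s \<le> 2/3 * B" unfolding s using gamma B_ge by (intro mult_right_mono) auto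
qed

lemma E_gap_square:
  assumes "k \<le> t" "t < T"
  shows "E (\<lambda>w. (gap k (Suc t) w)^2) = (1 - \<eta> (Suc t))^2 * E (\<lambda>w. (gap k t w)^2)
     + \<eta> (Suc t)^2 * (s / B^2) * E (\<lambda>w. (V t w)^2)"
proof -
  have "E (\<lambda>w. (gap k (Suc t) w)^2) = E (\<lambda>w. (1 - \<eta> (Suc t))^2 * (gap k t w)^2
     + \<eta> (Suc t)^2 * (2 * p * (1 - p) * \<gamma>^2) * (V t w)^2)"
  proof -
    have id: "1 * ((p^2 + (1-p)^2) * (c * x)^2 + p * (1-p) * ((c * x + e * \<gamma> * v)^2 + (c * x - e * \<gamma> * v)^2))
      = c^2 * x^2 + e^2 * (2 * p * (1 - p) * \<gamma>^2) * v^2" for c e x v :: real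
      unfolding p_sum by (simp add: algebra_simps power2_eq_square)
    show ?thesis
      using E_gap_Suc[OF assms, of "\<lambda>w. 1" "\<lambda>x. x^2"] unfolding id by (simp only: mult_1)
  qed
  moreover have "2 * p * (1 - p) * \<gamma>^2 = s / B^2" using B_ge by (simp add: s_def)
  ultimately show ?thesis by (simp del: gap.simps)
qed

text \<open>Odd powers of the noise cancel by symmetry. In its fourth moment one factor \<gamma>^2
  V^2 is absorbed with the probability into \<open>s\<close> and the other is bounded by
  \<open>B^2\<close>, so the bound stays linear in \<open>s\<close>.\<close>

lemma E_gap_fourth:
  assumes "k \<le> t" "t < T"
  shows "E (\<lambda>w. (gap k (Suc t) w)^4) \<le> (1 - \<eta> (Suc t))^4 * E (\<lambda>w. (gap k t w)^4)
     + 6 * (1 - \<eta> (Suc t))^2 * \<eta> (Suc t)^2 * s * E (\<lambda>w. (gap k t w)^2) + \<eta> (Suc t)^4 * s * B^2"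
proof -
  let ?e = "\<eta> (Suc t)"
  have "E (\<lambda>w. (gap k (Suc t) w)^4) = E (\<lambda>w. ((1 - ?e) * gap k t w)^4
     + 2 * p * (1 - p) * (6 * ((1 - ?e) * gap k t w)^2 * (?e * \<gamma> * V t w)^2 + (?e * \<gamma> * V t w)^4))"
  proof -
    have "(x + v)^4 + (x - v)^4 = 2 * x^4 + 12 * x^2 * v^2 + 2 * v^4" for x v :: real
      by (simp add: power4_eq_xxxx power2_eq_square algebra_simps)
    then have id: "1 * ((p^2 + (1-p)^2) * x^4 + p * (1-p) * ((x + v)^4 + (x - v)^4))
      = x^4 + 2 * p * (1 - p) * (6 * x^2 * v^2 + v^4)" for x v :: real
      unfolding p_sum by (simp only:) (simp add: algebra_simps)
    show ?thesis
      using E_gap_Suc[OF assms, of "\<lambda>w. 1" "\<lambda>x. x^4"] unfolding id by (simp only: mult_1)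
  qed
  also have "\<dots> \<le> E (\<lambda>w. (1 - ?e)^4 * (gap k t w)^4 + 6 * (1 - ?e)^2 * ?e^2 * s * (gap k t w)^2 + ?e^4 * s * B^2)"
  proof (rule E_mono)
    fix w
    have v2: "(V t w)^2 \<le> B^2" using V_bounds by (intro power_mono) auto
    have g2: "0 \<le> \<gamma>^2" "\<gamma>^2 \<le> 1" using gamma by (auto simp: power_le_one)
    have gv: "\<gamma>^2 * (V t w)^2 \<le> B^2" using mult_mono[OF g2(2) v2] by simp
    have pp: "0 \<le> 2 * p * (1 - p)" using p01 by simp
    have a: "2 * p * (1 - p) * (\<gamma>^2 * (V t w)^2) \<le> s"
      using mult_left_mono[OF mult_left_mono[OF v2 g2(1)] pp] by (simp add: s_def mult.assoc)
    have "2 * p * (1 - p) * (6 * ((1 - ?e) * gap k t w)^2 * (?e * \<gamma> * V t w)^2 + (?e * \<gamma> * V t w)^4)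
       = 6 * (1 - ?e)^2 * ?e^2 * (gap k t w)^2 * (2 * p * (1 - p) * (\<gamma>^2 * (V t w)^2))
        + ?e^4 * ((2 * p * (1 - p) * (\<gamma>^2 * (V t w)^2)) * (\<gamma>^2 * (V t w)^2))"
      by (simp add: power_mult_distrib power4_eq_xxxx power2_eq_square algebra_simps)
    also have "\<dots> \<le> 6 * (1 - ?e)^2 * ?e^2 * (gap k t w)^2 * s + ?e^4 * (s * B^2)"
      using a gv s_bounds by (intro add_mono mult_left_mono mult_mono) auto
    finally show "((1 - ?e) * gap k t w)^4
     + 2 * p * (1 - p) * (6 * ((1 - ?e) * gap k t w)^2 * (?e * \<gamma> * V t w)^2 + (?e * \<gamma> * V t w)^4)
      \<le> (1 - ?e)^4 * (gap k t w)^4 + 6 * (1 - ?e)^2 * ?e^2 * s * (gap k t w)^2 + ?e^4 * s * B^2"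
      by (simp add: power_mult_distrib mult_ac)
  qed
  finally show ?thesis by (simp del: gap.simps)
qed

text \<open>On a window where the step sizes are comparable to \<open>h\<close>, the second moment
  of the gap is of order \<open>h * s * m\<close>, where \<open>m\<close> measures how far the
  window carries it to equilibrium. The fourth moment is at most of order
  \<open>h * s * m * W\<close>, so the typical size of the gap is controlled by
  \<open>sqrt W\<close>.\<close>

lemma E_abs_gap_lower:
  assumes kt: "k < t" "t \<le> T" and h: "0 < h" "h \<le> 1"
    and eta: "\<And>i. k < i \<Longrightarrow> i \<le> t \<Longrightarrow> h \<le> \<eta> i \<and> \<eta> i \<le> 2 * h"
    and V2: "\<And>i. k \<le> i \<Longrightarrow> i < t \<Longrightarrow> 9/64 * B^2 \<le> E (\<lambda>w. (V i w)^2)"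
    and m: "m = min 1 (h * real (t - k))"
  shows "9 / 2^30 * (h * m^2 * B) \<le> (4 * m + h * B) * (E (\<lambda>w. \<bar>gap k t w\<bar>))^2"
proof -
  define A where "A j = E (\<lambda>w. (gap k j w)^2)" for j
  define F where "F j = E (\<lambda>w. (gap k j w)^4)" for j
  define n where "n = t - k"
  have t: "t = k + n" and n: "0 < n" using kt by (auto simp: n_def)
  have m_pos: "0 < m" and m1: "m \<le> 1" using n h by (auto simp: m n_def)
  have A0: "A k = 0" and F0: "F k = 0" by (simp_all add: A_def F_def gap_early)
  have A_nonneg: "0 \<le> A j" and F_nonneg: "0 \<le> F j" for j
    unfolding A_def F_def using E_mono[of "\<lambda>w. 0"] by auto
  have sB: "0 < s" "0 < B" using s_bounds B_ge by auto
  have e: "h \<le> \<eta> (Suc i)" "\<eta> (Suc i) \<le> 2 * h" "0 \<le> 1 - \<eta> (Suc i)" if "k \<le> i" "i < k + n" for i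
    using eta[of "Suc i"] eta_le[of "Suc i"] that t by auto
  have EV: "E (\<lambda>w. (V i w)^2) \<le> B^2" for i
    using E_mono[of "\<lambda>w. (V i w)^2" "\<lambda>w. B^2"] V_bounds by (simp add: power_mono)
  have EV0: "0 \<le> E (\<lambda>w. (V i w)^2)" for i
    using E_mono[of "\<lambda>w. 0" "\<lambda>w. (V i w)^2"] by simp
  have A_eq: "A (Suc i) = (1 - \<eta> (Suc i))^2 * A i + \<eta> (Suc i)^2 * (s / B^2) * E (\<lambda>w. (V i w)^2)"
    if "k \<le> i" "i < k + n" for i
    unfolding A_def using that kt t by (intro E_gap_square) auto
  have sq: "(1 - x)^2 \<le> 1 - h" if "h \<le> x" "0 \<le> 1 - x" for x :: real
  proof -
    have "(1 - x) * (1 - x) \<le> (1 - x) * 1" using that h by (intro mult_left_mono) auto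
    then show ?thesis using that by (simp add: power2_eq_square)
  qed
  have A_upper: "A (k + j) \<le> 4 * h * s * m" if "j \<le> n" for j
  proof -
    have "A (k + j) \<le> 4 * h^2 * s / h * min 1 (h * real j)"
    proof (rule affine_recursion_upper[where x = A, OF A0 _ h _ that])
      fix i assume i: "k \<le> i" "i < k + n"
      have "\<eta> (Suc i)^2 * (s / B^2) * E (\<lambda>w. (V i w)^2) \<le> (2 * h)^2 * (s / B^2) * B^2"
        using e[OF i] h sB EV EV0 by (intro mult_mono power_mono) auto
      moreover have "(1 - \<eta> (Suc i))^2 * A i \<le> (1 - h) * A i"
        using sq e[OF i] A_nonneg by (intro mult_right_mono) auto
      ultimately show "A (Suc i) \<le> (1 - h) * A i + 4 * h^2 * s"
        unfolding A_eq[OF i] using sB by (simp add: power_mult_distrib)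
    qed (use sB in simp)
    also have "\<dots> \<le> 4 * h^2 * s / h * m"
      using that h sB unfolding m n_def[symmetric] by (intro mult_left_mono min.mono) auto
    finally show ?thesis using h by (simp add: power2_eq_square)
  qed
  have A_noise: "h^2 * (9/64 * s) \<le> \<eta> (Suc i)^2 * (s / B^2) * E (\<lambda>w. (V i w)^2)"
    if i: "k \<le> i" "i < k + n" for i
  proof -
    have "h^2 * (s / B^2) * (9/64 * B^2) \<le> \<eta> (Suc i)^2 * (s / B^2) * E (\<lambda>w. (V i w)^2)"
      using e[OF i] h sB EV0 V2[OF i(1)] i t by (intro mult_mono power_mono) auto
    then show ?thesis using sB by simp
  qed
  have A_lower: "9/512 * (h * s * m) \<le> A t"
  proof (cases "h \<le> 1/4")
    case True
    have "h^2 * (9/64 * s) / (4 * h) * (min 1 (4 * h * real n) / 2) \<le> A (k + n)"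
    proof (rule affine_recursion_lower[where x = A, OF A0])
      fix i assume i: "k \<le> i" "i < k + n"
      \<comment> \<open>The decay rate for the lower bound is \<open>4 * h\<close>, as the steps may
        be as large as \<open>2 * h\<close>; this needs \<open>h\<close> at most 1/4.\<close>
      have "1 - 4 * h \<le> (1 - 2 * h)^2" by (simp add: power2_eq_square algebra_simps)
      also have "\<dots> \<le> (1 - \<eta> (Suc i))^2" using e[OF i] True by (intro power_mono) auto
      finally have "(1 - 4 * h) * A i \<le> (1 - \<eta> (Suc i))^2 * A i"
        using A_nonneg by (intro mult_right_mono) auto
      with A_noise[OF i] show "(1 - 4 * h) * A i + h^2 * (9/64 * s) \<le> A (Suc i)"
        unfolding A_eq[OF i] by linarith
    qed (use True h sB in auto)
    moreover have "h^2 * (9/64 * s) / (4 * h) * (m / 2) \<le> h^2 * (9/64 * s) / (4 * h) * (min 1 (4 * h * real n) / 2)"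
      using h sB unfolding m n_def[symmetric] by (intro mult_left_mono divide_right_mono min.mono) auto
    moreover have "h^2 * (9/64 * s) / (4 * h) * (m / 2) = 9/512 * (h * s * m)"
      using h by (simp add: power2_eq_square)
    ultimately show ?thesis unfolding t by linarith
  next
    case False
    \<comment> \<open>For larger \<open>h\<close> the noise of the last step alone suffices, since m
      \<le> 1 < 8 h.\<close>
    obtain i where i: "t = Suc i" using kt by (cases t) auto
    have ki: "k \<le> i" "i < k + n" using i t kt by auto
    have "9/512 * (h * s * m) \<le> 9/512 * (h * s * (8 * h))"
      using False m1 h sB by (intro mult_left_mono) auto
    also have "\<dots> = h^2 * (9/64 * s)" by (simp add: power2_eq_square)
    also have "\<dots> \<le> A t"
      unfolding i A_eq[OF ki] using A_noise[OF ki] A_nonneg[of i] by (simp add: add_increasing)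
    finally show ?thesis .
  qed
  define W where "W = h * B * (4 * m + h * B)"
  have W: "0 < W" using h sB m_pos by (simp add: W_def add_pos_pos)
  have F_upper: "F t \<le> 16 * (h * s * m) * W"
  proof -
    let ?c = "96 * h^3 * s^2 * m + 16 * h^4 * s * B^2"
    have "F (k + n) \<le> ?c / h * min 1 (h * real n)"
    proof (rule affine_recursion_upper[where x = F and n = n, OF F0 _ h])
      fix i assume i: "k \<le> i" "i < k + n"
      let ?e = "\<eta> (Suc i)"
      have e1: "(1 - ?e)^2 \<le> 1" using e[OF i] h by (intro power_le_one) auto
      have "(1 - ?e)^4 = (1 - ?e)^2 * (1 - ?e)^2" by (simp flip: power_add)
      also have "\<dots> \<le> (1 - h) * 1" using sq e[OF i] e1 h by (intro mult_mono) auto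
      finally have "(1 - ?e)^4 * F i \<le> (1 - h) * F i" using F_nonneg by (intro mult_right_mono) auto
      moreover have "6 * (1 - ?e)^2 * ?e^2 * s * A i \<le> 6 * 1 * (2 * h)^2 * s * (4 * h * s * m)"
        using e1 e[OF i] h sB A_nonneg A_upper[of "i - k"] i
        by (intro mult_mono power_mono mult_left_mono) auto
      moreover have "?e^4 * s * B^2 \<le> (2 * h)^4 * s * B^2"
        using e[OF i] h sB by (intro mult_right_mono power_mono) auto
      moreover have "F (Suc i) \<le> (1 - ?e)^4 * F i + 6 * (1 - ?e)^2 * ?e^2 * s * A i + ?e^4 * s * B^2"
        unfolding F_def A_def using i kt t by (intro E_gap_fourth) auto
      ultimately show "F (Suc i) \<le> (1 - h) * F i + ?c"
        by (simp add: power2_eq_square power3_eq_cube power4_eq_xxxx algebra_simps)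
    qed (use h sB m_pos in auto)
    also have "\<dots> = 16 * (h * s * m) * (h * (6 * s) * m + h^2 * B^2)"
      using h unfolding m n_def[symmetric]
      by (simp add: power2_eq_square power3_eq_cube power4_eq_xxxx field_simps)
    also have "\<dots> \<le> 16 * (h * s * m) * (h * (4 * B) * m + h^2 * B^2)"
      using h sB m_pos s_bounds by (intro mult_left_mono add_right_mono mult_right_mono) auto
    finally show ?thesis
      by (simp add: W_def t power2_eq_square algebra_simps)
  qed
  \<comment> \<open>This level makes the fourth moment term at most
    \<open>9/1024 * (h * s * m)\<close>, half of the lower bound for \<open>A t\<close>.\<close>
  define a where "a = sqrt (16384/9 * W)"
  have a: "0 < a" "a^2 = 16384/9 * W" using W by (simp_all add: a_def)
  define d where "d = E (\<lambda>w. \<bar>gap k t w\<bar>)"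
  have "A t \<le> E (\<lambda>w. a * \<bar>gap k t w\<bar> + (gap k t w)^4 / a^2)"
    unfolding A_def by (rule E_mono) (rule square_le_abs_plus_fourth[OF a(1)])
  then have "A t \<le> a * d + F t / a^2" by (simp add: F_def d_def)
  also have "F t / a^2 \<le> 16 * (h * s * m) * W / (16384/9 * W)"
    unfolding a(2) using F_upper W by (intro divide_right_mono) auto
  also have "\<dots> = 9/1024 * (h * s * m)" using W by simp
  finally have "9/1024 * (h * s * m) \<le> a * d" using A_lower by linarith
  then have "(9/1024 * (h * s * m))^2 \<le> (a * d)^2" using h sB m_pos by (intro power_mono) auto
  moreover have "(9/1024 * (h * (4/9 * B) * m))^2 \<le> (9/1024 * (h * s * m))^2"
    using h sB m_pos s_bounds by (intro power_mono mult_left_mono mult_right_mono) auto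
  ultimately have "(9/1024 * (h * (4/9 * B) * m))^2 \<le> 16384/9 * W * d^2"
    by (simp add: power_mult_distrib a(2))
  then have "(h * B) * (9 / 2^30 * (h * m^2 * B)) \<le> (h * B) * ((4 * m + h * B) * d^2)"
    by (simp add: W_def power2_eq_square field_simps)
  then show ?thesis using h sB unfolding d_def by (simp only: mult_le_cancel_left_pos mult_pos_pos)
qed

section \<open>Decay of the initialization and growth of the mean at state 1\<close>

definition P :: "nat \<Rightarrow> real" where "P t = (\<Prod>i=1..t. 1 - \<eta> i * \<beta>)"

lemma P_0 [simp]: "P 0 = 1" and P_Suc: "P (Suc t) = P t * (1 - \<eta> (Suc t) * \<beta>)"
  by (simp_all add: P_def)

lemma P_factor: "1 \<le> i \<Longrightarrow> 2/3 \<le> 1 - \<eta> i * \<beta>" "1 \<le> i \<Longrightarrow> 1 - \<eta> i * \<beta> \<le> 1"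
  using mult_mono[OF eta_le[of i] beta(2)] eta_pos[of i] beta by auto

lemma P_pos: "0 < P t"
  unfolding P_def by (intro prod_pos) (use P_factor in force)

lemma P_antimono: "i \<le> j \<Longrightarrow> P j \<le> P i"
proof (induction j rule: dec_induct)
  case (step j)
  have "P j * (1 - \<eta> (Suc j) * \<beta>) \<le> P j * 1"
    using P_pos[of j] P_factor(2)[of "Suc j"] by (intro mult_left_mono) auto
  with step show ?case by (simp add: P_Suc)
qed simp

lemma E_abs_nonneg: "0 \<le> E (\<lambda>w. \<bar>f w\<bar>)"
  using E_mono[of "\<lambda>w. 0" "\<lambda>w. \<bar>f w\<bar>"] by simp

text \<open>Dropping the nonnegative gap term from \<open>E_M_Suc\<close> leaves a linear recursion
  solved exactly by the left-hand side.\<close>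

lemma E_M_lower:
  assumes "t \<le> T"
  shows "(1 - P t) / \<beta> \<le> E (M t)"
  using assms
proof (induction t)
  case 0
  show ?case using E_mono[of "\<lambda>w. 0" "M 0"] by (simp add: M_def)
next
  case (Suc t)
  have "(1 - P (Suc t)) / \<beta> = (1 - \<eta> (Suc t) * \<beta>) * ((1 - P t) / \<beta>) + \<eta> (Suc t)"
    using beta by (simp add: P_Suc field_simps)
  also have "\<dots> \<le> (1 - \<eta> (Suc t) * \<beta>) * E (M t) + \<eta> (Suc t) * (1 + (1 - \<beta>) * (E (\<lambda>w. \<bar>gap 0 t w\<bar>) / 2))"
    using Suc P_factor(1)[of "Suc t"] eta_pos[of "Suc t"] beta E_abs_nonneg[of "gap 0 t"]
    by (intro add_mono mult_left_mono) auto
  finally show ?case using E_M_Suc[of t] Suc.prems by simp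
qed

lemma E_V_square_lower:
  assumes "t \<le> T" "P t \<le> 1/2"
  shows "9/64 * B^2 \<le> E (\<lambda>w. (V t w)^2)"
proof -
  \<comment> \<open>Once half of the initialization is forgotten, the mean is at least half its
    limit 1/\<beta>; 9/64 is the square of 3/8.\<close>
  have "3/8 * B = (1/2) * (1/\<beta>)" by (simp add: inverse_beta)
  also have "\<dots> \<le> (1 - P t) * (1/\<beta>)" using assms beta by (intro mult_right_mono) auto
  also have "\<dots> \<le> E (M t)" using E_M_lower[OF assms(1)] by simp
  also have "\<dots> \<le> E (V t)" by (rule E_mono) (simp add: V_eq)
  finally have "(3/8 * B)^2 \<le> (E (V t))^2" using B_ge by (intro power_mono) auto
  with E_square_ge[of "V t"] show ?thesis by (simp add: power_mult_distrib power_divide)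
qed

text \<open>The left-hand side solves the recursion of \<open>E_M_Suc\<close> exactly when every gap
  from time \<open>k\<close> on is replaced by \<open>g\<close>; at time \<open>k\<close> its last
  term vanishes.\<close>

lemma E_M_bias:
  assumes "k \<le> t" "t \<le> T" and g: "\<And>i. k \<le> i \<Longrightarrow> i < T \<Longrightarrow> g \<le> E (\<lambda>w. \<bar>gap 0 i w\<bar>)"
  shows "1 / \<beta> - P t / \<beta> + (1 - \<beta>) * g / (2 * \<beta>) * (1 - P t / P k) \<le> E (M t)"
  using assms(1,2)
proof (induction t rule: dec_induct)
  case base
  then show ?case using E_M_lower[of k] P_pos[of k] by (simp add: diff_divide_distrib)
next
  case (step t)
  let ?L = "\<lambda>t. 1 / \<beta> - P t / \<beta> + (1 - \<beta>) * g / (2 * \<beta>) * (1 - P t / P k)"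
  have "?L (Suc t) = (1 - \<eta> (Suc t) * \<beta>) * ?L t + \<eta> (Suc t) * (1 + (1 - \<beta>) * (g / 2))"
    using beta P_pos[of k] by (simp add: P_Suc field_simps)
  also have "\<dots> \<le> (1 - \<eta> (Suc t) * \<beta>) * E (M t) + \<eta> (Suc t) * (1 + (1 - \<beta>) * (E (\<lambda>w. \<bar>gap 0 t w\<bar>) / 2))"
    using step P_factor(1)[of "Suc t"] eta_pos[of "Suc t"] beta g[of t]
    by (intro add_mono mult_left_mono) auto
  finally show ?case using E_M_Suc[of t] step by simp
qed

end

section \<open>The overestimation bias\<close>

text \<open>Arithmetic that turns the window estimate into the target rate. With z = B^2 / (T L^2)
  it suffices that z / 256 is at most both m^2 and h m B; the cases are a window reaching a quarter
  of equilibrium and a short one, where \<open>m = h * real n\<close>.\<close>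

lemma window_bound:
  fixes h m B L :: real and n T :: nat
  assumes h: "B / (4 * L * real T) \<le> h" and n: "0 < n" "n \<le> T" and m: "m = min 1 (h * real n)"
    and my: "min (1/4) (B / (16 * L)) \<le> m" and B: "4 \<le> B" and L: "1 \<le> L" and T: "B^2 \<le> real T"
  shows "B^2 / (real T * L^2) * (4 * m + h * B) \<le> 2048 * (h * m^2 * B)"
proof -
  define z where "z = B^2 / (real T * L^2)"
  have Tp: "1 \<le> real T" using n by simp
  have hp: "0 < h"
  proof -
    have "0 < B / (4 * L * real T)" using B L Tp by simp
    with h show ?thesis by linarith
  qed
  have mp: "0 < m" using hp n by (simp add: m)
  have L2: "L \<le> L^2" "1 \<le> L^2" using L self_le_power[of L 2] by auto
  have z1: "z \<le> 1"
  proof -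
    have "real T * 1 \<le> real T * L^2" using L2 by (intro mult_left_mono) auto
    with T have "B^2 \<le> real T * L^2" by linarith
    then show ?thesis using Tp L by (simp add: z_def divide_le_eq)
  qed
  have big: "z / 256 \<le> m^2 \<and> z / 256 \<le> h * m * B"
  proof (cases "1/4 \<le> m")
    case True
    have "(1/4)^2 \<le> m^2" using True by (intro power_mono) auto
    then have "1/16 \<le> m^2" by (simp add: power_divide)
    with z1 have "z / 256 \<le> m^2" by linarith
    moreover have "z / 256 \<le> B / (4 * L * real T) * (1/4) * B"
    proof -
      have "z / 256 \<le> B^2 / (real T * L) / 256"
        unfolding z_def using L2 L Tp by (intro divide_right_mono divide_left_mono mult_left_mono mult_pos_pos) auto
      also have "\<dots> \<le> B^2 / (real T * L) / 16" using L Tp by (intro divide_left_mono) auto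
      also have "\<dots> = B / (4 * L * real T) * (1/4) * B" by (simp add: power2_eq_square)
      finally show ?thesis .
    qed
    moreover have "\<dots> \<le> h * m * B" using h True hp B by (intro mult_mono) auto
    ultimately show ?thesis by linarith
  next
    case False
    then have mL: "B / (16 * L) \<le> m" and mh: "m = h * real n" using my m by (auto simp: min_def split: if_splits)
    have "(B / (16 * L))^2 \<le> m^2" using mL B L by (intro power_mono) auto
    then have m2: "B^2 / L^2 / 256 \<le> m^2" by (simp add: power_divide power_mult_distrib)
    have zT: "z = B^2 / L^2 / real T" by (simp add: z_def)
    have "z \<le> B^2 / L^2 / 1" unfolding zT using Tp by (intro divide_left_mono) auto
    then have "z / 256 \<le> B^2 / L^2 / 256" by simp
    also note m2
    finally have "z / 256 \<le> m^2" .
    moreover have "z / 256 \<le> h * m * B"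
    proof -
      have "z / 256 = B^2 / L^2 / 256 / real T" by (simp add: z_def)
      also have "\<dots> \<le> m^2 / real T" using m2 by (intro divide_right_mono) auto
      also have "\<dots> \<le> m^2 / real n" using n by (intro divide_left_mono) auto
      also have "\<dots> = h * m * 1" using n by (simp add: mh power2_eq_square)
      also have "\<dots> \<le> h * m * B" using hp mp B by (intro mult_left_mono) auto
      finally show ?thesis .
    qed
    ultimately show ?thesis by simp
  qed
  have "z * (4 * m) \<le> 256 * (h * m * B) * (4 * m)" using big mp by (intro mult_right_mono) auto
  moreover have "z * (h * B) \<le> 256 * m^2 * (h * B)" using big hp B by (intro mult_right_mono) auto
  moreover have "0 \<le> h * m^2 * B" using hp B by simp
  ultimately show ?thesis unfolding z_def[symmetric] by (simp add: power2_eq_square algebra_simps)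
qed

section \<open>Lower bound for regular step-size schedules\<close>

text \<open>\<open>eta_late\<close> guarantees that, once the total step size has reached 1, the
  window from \<open>t/2\<close> to \<open>t\<close> moves the gap a sufficient part of the way to
  equilibrium.\<close>

locale regular_schedule = hard_instance +
  assumes T_ge: "1 / (1 - \<gamma>)^2 \<le> real T"
    and eta_antimono: "1 \<le> i \<Longrightarrow> i \<le> j \<Longrightarrow> \<eta> j \<le> \<eta> i"
    and eta_growth: "1 \<le> i \<Longrightarrow> i \<le> j \<Longrightarrow> real i * \<eta> i \<le> real j * \<eta> j"
    and eta_late: "1 \<le> t \<Longrightarrow> t \<le> T \<Longrightarrow> 1 \<le> (\<Sum>i=1..t. \<eta> i) \<Longrightarrow> min (1/2) (real T * \<eta> T / 2) \<le> real t * \<eta> t"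
begin

definition L :: real where "L = ln (real T)"
text \<open>The target error relative to the scale \<open>B\<close>: (\<rho> B)^2 is the claimed
  bound with constant 1 / 2^48.\<close>

definition \<rho> :: real where "\<rho> = B / (2^24 * (sqrt (real T) * L))"

lemma B2_le_T: "B^2 \<le> real T"
  using T_ge by (simp add: B_def power_divide)

lemma T_ge_16: "16 \<le> real T"
proof -
  have "4^2 \<le> B^2" using B_ge by (intro power_mono) auto
  with B2_le_T show ?thesis by simp
qed

lemma L_ge: "1 \<le> L"
proof -
  have "exp 1 \<le> real T" using exp_le T_ge_16 by linarith
  then show ?thesis unfolding L_def using T_ge_16 by (subst ln_ge_iff) auto
qed

lemma rho: "0 < \<rho>" "\<rho> \<le> 1/18" "\<rho>^2 = B^2 / (real T * L^2) / 2^48"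
proof -
  show "0 < \<rho>" using B_ge T_ge_16 L_ge by (simp add: \<rho>_def)
  have "B \<le> sqrt (real T)" using B2_le_T by (simp add: real_le_rsqrt)
  also have "\<dots> \<le> sqrt (real T) * L" using mult_left_mono[OF L_ge, of "sqrt (real T)"] by simp
  finally have "B \<le> sqrt (real T) * L" .
  moreover have "0 < sqrt (real T) * L" using T_ge_16 L_ge by simp
  moreover have "B / (2^24 * x) \<le> 1/18" if "B \<le> x" "0 < x" for x
    using that by (simp add: divide_le_eq)
  ultimately show "\<rho> \<le> 1/18" unfolding \<rho>_def by blast
  show "\<rho>^2 = B^2 / (real T * L^2) / 2^48"
    by (simp add: \<rho>_def power_divide power_mult_distrib)
qed

text \<open>Forgetting half of the initialization forces the sum of the steps to be at least
  \<open>B / 2\<close>. By \<open>eta_growth\<close> this sum is at most T \<eta>_T times a harmonic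
  sum, which is where the logarithm enters.\<close>

lemma eta_T_lower:
  assumes "(\<Prod>i=1..T. 1 - \<eta> i * (1 - \<gamma>)) \<le> 1/2"
  shows "B / (4 * L) \<le> real T * \<eta> T"
proof -
  have T1: "1 \<le> T" using T_ge_16 by simp
  have "1 - (\<Sum>i=1..T. \<eta> i * (1 - \<gamma>)) \<le> (\<Prod>i=1..T. 1 - \<eta> i * (1 - \<gamma>))"
  proof (rule Weierstrass_prod_ineq)
    fix i assume "i \<in> {1..T}"
    then show "\<eta> i * (1 - \<gamma>) \<in> {0..1}"
      using mult_mono[of "\<eta> i" 1 "1 - \<gamma>" 1] eta_le[of i] eta_pos[of i] gamma by auto
  qed
  with assms have "1/2 \<le> (\<Sum>i=1..T. \<eta> i) * (1 - \<gamma>)" unfolding sum_distrib_right by linarith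
  then have "B / 2 \<le> (\<Sum>i=1..T. \<eta> i)" using gamma by (simp add: B_def field_simps)
  also have "\<dots> \<le> (\<Sum>i=1..T. real T * \<eta> T * (1 / real i))"
  proof (rule sum_mono)
    fix i assume "i \<in> {1..T}"
    then show "\<eta> i \<le> real T * \<eta> T * (1 / real i)"
      using eta_growth[of i T] by (simp add: field_simps)
  qed
  also have "\<dots> = real T * \<eta> T * (\<Sum>i=1..T. 1 / real i)" by (simp add: sum_distrib_left)
  also have "\<dots> \<le> real T * \<eta> T * (2 * L)"
    using sum_inverse_le_ln[OF T1] L_ge eta_pos[OF T1] unfolding L_def
    by (intro mult_left_mono) auto
  finally show ?thesis using L_ge by (simp add: field_simps)
qed

text \<open>Restarts the gap at \<open>t div 2\<close>: for \<open>i\<close> in the second half,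
  monotonicity of i \<eta>_i and t \<le> 2 i give \<eta>_i \<le> 2 \<eta>_t, and t \<ge> 2 k ensures
  that \<open>V\<close> is already of order \<open>B\<close> on the whole window.\<close>

lemma E_abs_gap_0_lower:
  assumes y: "B / (4 * L) \<le> real T * \<eta> T" and k: "1 \<le> k" "P k \<le> 1/2" and t: "2 * k \<le> t" "t \<le> T"
  shows "16 * \<rho> \<le> E (\<lambda>w. \<bar>gap 0 t w\<bar>)"
proof -
  define j where "j = t div 2"
  define m where "m = min 1 (\<eta> t * real (t - j))"
  define d where "d = E (\<lambda>w. \<bar>gap j t w\<bar>)"
  have j: "k \<le> j" "j < t" "t \<le> 2 * (t - j)" "t < 2 * Suc j" using k t by (auto simp: j_def)
  have t1: "1 \<le> t" using k t by simp
  have ht: "0 < \<eta> t" "\<eta> t \<le> 1" using eta_pos[OF t1] eta_le[OF t1] by auto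
  have "9 / 2^30 * (\<eta> t * m^2 * B) \<le> (4 * m + \<eta> t * B) * d^2"
    unfolding d_def
  proof (rule E_abs_gap_lower[OF j(2) t(2) ht])
    fix i assume i: "j < i" "i \<le> t"
    have "real i * \<eta> i \<le> real t * \<eta> t" using i by (intro eta_growth) auto
    also have "\<dots> \<le> (2 * real i) * \<eta> t" using i j ht by (intro mult_right_mono) auto
    finally have "real i * \<eta> i \<le> real i * (2 * \<eta> t)" by (simp add: mult_ac)
    then have "\<eta> i \<le> 2 * \<eta> t" using i by (subst (asm) mult_le_cancel_left_pos) auto
    then show "\<eta> t \<le> \<eta> i \<and> \<eta> i \<le> 2 * \<eta> t" using eta_antimono[of i t] i by auto
  next
    fix i assume "j \<le> i" "i < t"
    then show "9/64 * B^2 \<le> E (\<lambda>w. (V i w)^2)"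
      using P_antimono[of k i] j k t by (intro E_V_square_lower) auto
  qed (rule m_def)
  moreover have "B^2 / (real T * L^2) * (4 * m + \<eta> t * B) \<le> 2048 * (\<eta> t * m^2 * B)"
  proof (rule window_bound[OF _ _ _ m_def _ B_ge L_ge B2_le_T])
    have "B / (4 * L) / real T \<le> \<eta> T" using divide_right_mono[OF y, of "real T"] T_ge_16 by simp
    then show "B / (4 * L * real T) \<le> \<eta> t" using eta_antimono[OF t1 t(2)] by simp
    show "0 < t - j" "t - j \<le> T" using j t by auto
    have "1 - (\<Sum>i=1..t. \<eta> i * \<beta>) \<le> P t"
      unfolding P_def
    proof (rule Weierstrass_prod_ineq)
      fix i assume "i \<in> {1..t}"
      then show "\<eta> i * \<beta> \<in> {0..1}"
        using P_factor(1)[of i] eta_pos[of i] beta by auto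
    qed
    also have "P t \<le> 1/2" using P_antimono[of k t] k t by simp
    finally have "1/2 \<le> (\<Sum>i=1..t. \<eta> i) * \<beta>" unfolding sum_distrib_right by linarith
    \<comment> \<open>Hence the steps up to \<open>t\<close> sum to at least 1, the premise of
      \<open>eta_late\<close>.\<close>
    also have "\<dots> \<le> (\<Sum>i=1..t. \<eta> i) * (1/2)"
      using beta eta_pos by (intro mult_left_mono sum_nonneg) (auto simp: less_imp_le)
    finally have "min (1/2) (real T * \<eta> T / 2) \<le> real t * \<eta> t"
      using t1 t by (intro eta_late) auto
    also have "\<dots> \<le> 2 * real (t - j) * \<eta> t"
      using j ht by (intro mult_right_mono) linarith+
    finally have "min (1/2) (real T * \<eta> T / 2) \<le> 2 * (\<eta> t * real (t - j))"
      by (simp only: mult_ac)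
    moreover have "B / (16 * L) \<le> real T * \<eta> T / 4" using y by simp
    ultimately show "min (1/4) (B / (16 * L)) \<le> m" unfolding m_def by linarith
  qed
  moreover have "0 < 4 * m + \<eta> t * B" using ht B_ge j by (auto simp: m_def intro!: add_nonneg_pos)
  moreover have "0 \<le> \<eta> t * m^2 * B" using ht B_ge by simp
  \<comment> \<open>As 2048 / 2^38 = 8 / 2^30, the constant 9 / 2^30 suffices for 2^10 \<rho>^2,
    that is, for a restarted gap of 32 \<rho>; the restart then halves it.\<close>
  moreover have "N * (2^10 * (z / 2^48)) \<le> N * d^2"
    if "9 / 2^30 * X \<le> N * d^2" "z * N \<le> 2048 * X" "0 \<le> X" for N X z :: real
  proof -
    have "N * (2^10 * (z / 2^48)) = z * N / 2^38" by simp
    also have "\<dots> \<le> 2048 * X / 2^38" using that by (intro divide_right_mono) auto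
    also have "\<dots> \<le> 9 / 2^30 * X" using that by simp
    also note that(1)
    finally show ?thesis .
  qed
  ultimately have "(4 * m + \<eta> t * B) * (2^10 * \<rho>^2) \<le> (4 * m + \<eta> t * B) * d^2"
    unfolding rho(3) by blast
  then have "(32 * \<rho>)^2 \<le> d^2"
    using \<open>0 < 4 * m + \<eta> t * B\<close> by (subst (asm) mult_le_cancel_left_pos) (auto simp: power_mult_distrib)
  then have "32 * \<rho> \<le> d" by (rule power2_le_imp_le) (simp add: d_def E_abs_nonneg)
  then show ?thesis using E_abs_gap_restart[of j t] j t unfolding d_def by simp
qed

text \<open>Let \<open>k\<close> be the first time that half of the initialization is forgotten. The
  gaps from time \<open>2 * k\<close> on add a bias of at least 2 B \<rho>, while the remaining
  initialization costs at most 3/4 B \<rho>.\<close>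

lemma bias_lower:
  assumes R: "(\<Prod>i=1..T. 1 - \<eta> i * (1 - \<gamma>)) \<le> \<rho>"
  shows "\<rho> * B \<le> E (V T) - 1 / \<beta>"
proof -
  have y: "B / (4 * L) \<le> real T * \<eta> T" using R rho by (intro eta_T_lower) auto
  have "P T \<le> (\<Prod>i=1..T. 1 - \<eta> i * (1 - \<gamma>))"
    unfolding P_def
  proof (rule prod_mono)
    fix i assume "i \<in> {1..T}"
    then have i: "1 \<le> i" by simp
    have "\<eta> i * (1 - \<gamma>) \<le> \<eta> i * \<beta>" using eta_pos[OF i] gamma by (simp add: \<beta>_def)
    then show "0 \<le> 1 - \<eta> i * \<beta> \<and> 1 - \<eta> i * \<beta> \<le> 1 - \<eta> i * (1 - \<gamma>)" using P_factor(1)[OF i] by simp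
  qed
  with R have PT: "P T \<le> \<rho>" by simp
  define k where "k = (LEAST k. P k \<le> 1/2)"
  have Pk: "P k \<le> 1/2" unfolding k_def by (rule LeastI[of _ T]) (use PT rho in simp)
  have k1: "1 \<le> k" using Pk by (cases k) auto
  have "\<not> P (k - 1) \<le> 1/2" using k1 not_less_Least[of "k - 1" "\<lambda>k. P k \<le> 1/2"] unfolding k_def by simp
  moreover have "P k = P (k - 1) * (1 - \<eta> k * \<beta>)" using k1 P_Suc[of "k - 1"] by simp
  ultimately have "1/2 * (2/3) \<le> P k" using P_factor(1)[OF k1] by (simp only:) (intro mult_mono, auto)
  then have P3: "1/3 \<le> P k" by simp
  \<comment> \<open>Later steps are smaller, so the decay over \<open>i\<close> steps after time
    \<open>k\<close> is no stronger than over the first \<open>i\<close> steps. Thus P (2 k) \<ge>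
    1/9, which exceeds P T, and so time \<open>2 * k\<close> comes before \<open>T\<close>.\<close>
  have "P (k + i) \<ge> P k * P i" for i
  proof (induction i)
    case (Suc i)
    have "P k * P (Suc i) = P k * P i * (1 - \<eta> (Suc i) * \<beta>)" by (simp add: P_Suc)
    also have "\<dots> \<le> P (k + i) * (1 - \<eta> (Suc (k + i)) * \<beta>)"
      using Suc P_pos[of "k + i"] P_factor(1)[of "Suc i"] eta_antimono[of "Suc i" "Suc (k + i)"] beta
      by (intro mult_mono diff_left_mono mult_right_mono) auto
    finally show ?case by (simp add: P_Suc)
  qed simp
  from this[of k] have "P k * P k \<le> P (2 * k)" by (simp add: mult_2)
  moreover have "1/3 * (1/3) \<le> P k * P k" using P3 by (intro mult_mono) auto
  ultimately have P9: "1/9 \<le> P (2 * k)" by simp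
  have kT: "2 * k \<le> T"
  proof (rule ccontr)
    assume "\<not> 2 * k \<le> T"
    then have "P (2 * k) \<le> P T" by (intro P_antimono) auto
    with P9 PT rho show False by simp
  qed
  have "P T / P (2 * k) \<le> (1/18) / (1/9)"
    using P9 PT rho P_pos[of T] by (intro frac_le) auto
  then have half: "1/2 \<le> 1 - P T / P (2 * k)" by simp
  have "P T / \<beta> \<le> \<rho> / \<beta>" using PT beta by (intro divide_right_mono) auto
  also have "\<dots> = 3/4 * B * \<rho>" using arg_cong[OF inverse_beta, of "\<lambda>x. x * \<rho>"] by simp
  finally have b1: "P T / \<beta> \<le> 3/4 * B * \<rho>" .
  have "2 * B * \<rho> = (2/3) * (16 * \<rho>) / 2 * (3/4 * B) * (1/2)" by simp
  also have "\<dots> \<le> (1 - \<beta>) * (16 * \<rho>) / 2 * (1 / \<beta>) * (1 - P T / P (2 * k))"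
    unfolding inverse_beta using beta B_ge rho half
    by (intro mult_mono divide_right_mono) auto
  also have "\<dots> = (1 - \<beta>) * (16 * \<rho>) / (2 * \<beta>) * (1 - P T / P (2 * k))" by simp
  finally have b2: "2 * B * \<rho> \<le> (1 - \<beta>) * (16 * \<rho>) / (2 * \<beta>) * (1 - P T / P (2 * k))" .
  have "1 / \<beta> - P T / \<beta> + (1 - \<beta>) * (16 * \<rho>) / (2 * \<beta>) * (1 - P T / P (2 * k)) \<le> E (M T)"
    by (rule E_M_bias[OF kT order_refl]) (use E_abs_gap_0_lower[OF y k1 Pk] in auto)
  moreover have "E (M T) \<le> E (V T)" by (rule E_mono) (simp add: V_eq)
  moreover have "0 \<le> B * \<rho>" using B_ge rho by simp
  ultimately show ?thesis using b1 b2 mult.commute[of \<rho> B] by linarith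
qed

lemma QL_error_lower:
  "(1 / 2^48) / ((1 - \<gamma>)^4 * real T * (ln (real T))^2) \<le> QL_error 4 2 (hard_kernel p) hard_reward \<gamma> \<eta> T"
proof -
  have g: "0 \<le> \<gamma>" "\<gamma> < 1" using gamma by auto
  have "(1 / 2^48) / ((1 - \<gamma>)^4 * real T * (ln (real T))^2) = B^4 / (real T * L^2) / 2^48"
    by (simp add: B_def L_def power_divide)
  also have "B^4 = B^2 * B^2" by (simp flip: power_add)
  also have "B^2 * B^2 / (real T * L^2) / 2^48 = (\<rho> * B)^2"
    by (simp add: power_mult_distrib rho(3))
  also have "\<dots> \<le> QL_error 4 2 (hard_kernel p) hard_reward \<gamma> \<eta> T"
  \<comment> \<open>Either the absorbing state 2 still remembers its initialization, or the steps
    were large enough for the maximization bias at state 1.\<close>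
  proof (cases "\<rho> \<le> (\<Prod>i=1..T. 1 - \<eta> i * (1 - \<gamma>))")
    case True
    then have "(\<rho> * B)^2 \<le> ((\<Prod>i=1..T. 1 - \<eta> i * (1 - \<gamma>)) / (1 - \<gamma>))^2"
      using rho g unfolding B_def times_divide_eq_right mult_1_right
      by (intro power_mono divide_right_mono) auto
    also have "\<dots> \<le> QL_error 4 2 (hard_kernel p) hard_reward \<gamma> \<eta> T"
      by (rule QL_error_ge_absorbing[OF p01 g])
    finally show ?thesis .
  next
    case False
    then have "\<rho> * B \<le> E (V T) - 1 / \<beta>" by (intro bias_lower) simp
    moreover have "1 - \<gamma> * p = \<beta>" by (simp add: gamma_p)
    ultimately show ?thesis
      using rho B_ge by (intro QL_error_ge_bias[OF p01 g]) (simp_all add: E_def V_def [abs_def])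
  qed
  finally show ?thesis .
qed

end

section \<open>The two families of step sizes and the conclusion\<close>

lemma hyperbolic_schedule:
  assumes "3/4 \<le> \<gamma>" "\<gamma> < 1" "1 / (1 - \<gamma>)^2 \<le> real T" "0 < c"
  shows "regular_schedule \<gamma> T (\<lambda>t. 1 / (1 + c * (1 - \<gamma>) * real t))"
proof
  define \<kappa> where "\<kappa> = c * (1 - \<gamma>)"
  have \<kappa>: "0 < \<kappa>" using assms by (simp add: \<kappa>_def)
  have pos: "0 < 1 + \<kappa> * real t" for t using \<kappa> by (simp add: add_pos_nonneg)
  show "0 < 1 / (1 + c * (1 - \<gamma>) * real t)" "1 / (1 + c * (1 - \<gamma>) * real t) \<le> 1" for t
    using pos[of t] \<kappa> unfolding \<kappa>_def[symmetric] by (auto simp: divide_le_eq)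
  fix i j :: nat assume ij: "i \<le> j"
  have "\<kappa> * real i \<le> \<kappa> * real j" using ij \<kappa> by simp
  then show "1 / (1 + c * (1 - \<gamma>) * real j) \<le> 1 / (1 + c * (1 - \<gamma>) * real i)"
    using pos unfolding \<kappa>_def[symmetric] by (intro divide_left_mono) auto
  show "real i * (1 / (1 + c * (1 - \<gamma>) * real i)) \<le> real j * (1 / (1 + c * (1 - \<gamma>) * real j))"
    using pos[of i] pos[of j] ij unfolding \<kappa>_def[symmetric] by (simp add: field_simps)
next
  define \<kappa> where "\<kappa> = c * (1 - \<gamma>)"
  have \<kappa>: "0 < \<kappa>" using assms by (simp add: \<kappa>_def)
  have pos: "0 < 1 + \<kappa> * real t" for t using \<kappa> by (simp add: add_pos_nonneg)
  fix t :: nat assume t: "1 \<le> t"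
  have "min (1/2) (real T * (1 / (1 + \<kappa> * real T)) / 2) \<le> real t * (1 / (1 + \<kappa> * real t))"
  \<comment> \<open>The increasing function t / (1 + \<kappa> t) has limit 1 / \<kappa>. For
    \<kappa> t \<le> 1 its value is at least t / 2; beyond that it has passed half of its
    limit.\<close>
  proof (cases "\<kappa> * real t \<le> 1")
    case True
    then have "1/2 \<le> real t * (1 / (1 + \<kappa> * real t))" using t pos[of t] by (simp add: field_simps)
    then show ?thesis by (rule min.coboundedI1)
  next
    case False
    have "real T * (1 / (1 + \<kappa> * real T)) / 2 \<le> 1 / (2 * \<kappa>)"
      using pos[of T] \<kappa> by (simp add: field_simps)
    also have "\<dots> \<le> real t * (1 / (1 + \<kappa> * real t))"
      using pos[of t] \<kappa> False by (simp add: field_simps)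
    finally show ?thesis by (rule min.coboundedI2)
  qed
  then show "min (1/2) (real T * (1 / (1 + c * (1 - \<gamma>) * real T)) / 2)
      \<le> real t * (1 / (1 + c * (1 - \<gamma>) * real t))"
    unfolding \<kappa>_def .
qed (use assms in auto)

lemma constant_schedule:
  assumes "3/4 \<le> \<gamma>" "\<gamma> < 1" "1 / (1 - \<gamma>)^2 \<le> real T" "0 < \<eta>" "\<eta> < 1"
  shows "regular_schedule \<gamma> T (\<lambda>t. \<eta>)"
  by unfold_locales (use assms in auto)

theorem theorem3:
  "\<exists>c3 clb :: real. c3 > 0 \<and> clb > 0 \<and>
     (\<forall>\<gamma> :: real. \<forall>T :: nat. 3/4 \<le> \<gamma> \<longrightarrow> \<gamma> < 1 \<longrightarrow> real T \<ge> c3 / (1 - \<gamma>)^2 \<longrightarrow>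
       (\<exists>K r. valid_mdp 4 2 K r \<and>
          (\<forall>c\<eta> :: real. c\<eta> > 0 \<longrightarrow>
             QL_error 4 2 K r \<gamma> (\<lambda>t. 1 / (1 + c\<eta> * (1 - \<gamma>) * real t)) T
               \<ge> clb / ((1 - \<gamma>)^4 * real T * (ln (real T))^2)) \<and>
          (\<forall>\<eta> :: real. 0 < \<eta> \<longrightarrow> \<eta> < 1 \<longrightarrow>
             QL_error 4 2 K r \<gamma> (\<lambda>t. \<eta>) T
               \<ge> clb / ((1 - \<gamma>)^4 * real T * (ln (real T))^2))))"
proof (rule exI[of _ 1], rule exI[of _ "1 / 2^48"], intro conjI allI impI)
  fix \<gamma> :: real and T :: nat
  assume A: "3/4 \<le> \<gamma>" "\<gamma> < 1" "1 / (1 - \<gamma>)^2 \<le> real T"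
  show "\<exists>K r. valid_mdp 4 2 K r \<and>
          (\<forall>c\<eta> :: real. c\<eta> > 0 \<longrightarrow>
             QL_error 4 2 K r \<gamma> (\<lambda>t. 1 / (1 + c\<eta> * (1 - \<gamma>) * real t)) T
               \<ge> 1 / 2^48 / ((1 - \<gamma>)^4 * real T * (ln (real T))^2)) \<and>
          (\<forall>\<eta> :: real. 0 < \<eta> \<longrightarrow> \<eta> < 1 \<longrightarrow>
             QL_error 4 2 K r \<gamma> (\<lambda>t. \<eta>) T
               \<ge> 1 / 2^48 / ((1 - \<gamma>)^4 * real T * (ln (real T))^2))"
    \<comment> \<open>The witness depends on \<gamma> only, so a single MDP serves all step sizes of
      both families.\<close>
    using regular_schedule.QL_error_lower[OF hyperbolic_schedule[OF A]]
      regular_schedule.QL_error_lower[OF constant_schedule[OF A]] valid_mdp_hard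
    by (intro exI[of _ "hard_kernel (hard_instance.p \<gamma>)"] exI[of _ hard_reward]) blast
qed auto

end
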